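(* Let $\mathbb{C}$ be a category with finite products equipped with a comonad $(F,\delta,\varepsilon)$, let $\mathbb{C}_F$ be its co-Kleisli category and $\mathrm{J}:\mathbb{C}\to\mathbb{C}_F$ the free functor induced by the comonadic adjunction. Suppose that for all objects $A$ of $\mathbb{C}$ the endofunctor $F(A\times -)$ has a bifree algebra, and let $\mathbf{fix}$ be the resulting parametrized fixpoint operator on $\mathbb{C}_F$, $\mathbf{fix}^X_A(f)=\mathrm{J}(u_f)\circ t_A$. Suppose moreover that $\mathbb{C}_F$ is a Cartesian differential category such that for every map $g$ in $\mathbb{C}$ the map $\mathrm{J}(g)$ is linear in $\mathbb{C}_F$. Then $\mathbf{fix}$ satisfies the tangent-fixpoint rule: for every map $f:A\times X\to X$ in $\mathbb{C}_F$, $\mathbf{T}(\mathbf{fix}^X_A(f))=\mathbf{fix}^{\mathbf{T}X}_{\mathbf{T}A}(\mathbf{T}(f)\circ c)$. Therefore $\mathbb{C}_F$ is a Cartesian differential fixpoint category.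
   Context: A left additive category is a category whose hom-sets are commutative monoids $(+,0)$ with $(f+g)\circ x=f\circ x+g\circ x$ and $0\circ x=0$. A map $f$ is additive if $f\circ(x+y)=f\circ x+f\circ y$ and $f\circ 0=0$. A Cartesian left additive category is a left additive category with finite products (terminal object $\top$, projections $\pi_j$, pairing $\langle -,\dots,-\rangle$) in which all projections are additive. A Cartesian differential category is a Cartesian left additive category $\mathbb{D}$ with a differential combinator: functions $\mathbf{D}:\mathbb{D}(A,B)\to\mathbb{D}(A\times A,B)$ such that: [CD.1] $\mathbf{D}[0]=0$, $\mathbf{D}[f+g]=\mathbf{D}[f]+\mathbf{D}[g]$; [CD.2] $\mathbf{D}[f]\circ\langle x,0\rangle=0$, $\mathbf{D}[f]\circ\langle x,y+z\rangle=\mathbf{D}[f]\circ\langle x,y\rangle+\mathbf{D}[f]\circ\langle x,z\rangle$; [CD.3] $\mathbf{D}[1_A]=\pi_2$, $\mathbf{D}[\pi_j]=\pi_j\circ\pi_2$; [CD.4] $\mathbf{D}[\langle f_1,\dots,f_n\rangle]=\langle\mathbf{D}[f_1],\dots,\mathbf{D}[f_n]\rangle$; [CD.5] $\mathbf{D}[g\circ f]=\mathbf{D}[g]\circ\langle f\circ\pi_1,\mathbf{D}[f]\rangle$; [CD.6] $\mathbf{D}[\mathbf{D}[f]]\circ\langle x,y,0,z\rangle=\mathbf{D}[f]\circ\langle x,z\rangle$; [CD.7] $\mathbf{D}[\mathbf{D}[f]]\circ\langle x,y,z,0\rangle=\mathbf{D}[\mathbf{D}[f]]\circ\langle x,z,y,0\rangle$.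 A map $f:A\to B$ is linear if $\mathbf{D}[f]=f\circ\pi_2$. The tangent bundle functor is $\mathbf{T}(A)=A\times A$, $\mathbf{T}(f)=\langle f\circ\pi_1,\mathbf{D}[f]\rangle$. Write $c=\langle\pi_1,\pi_3,\pi_2,\pi_4\rangle:A\times B\times C\times D\to A\times C\times B\times D$. A parametrized fixpoint operator on a category $\mathbb{D}$ with finite products is a family of functions $\mathbf{fix}^X_A:\mathbb{D}(A\times X,X)\to\mathbb{D}(A,X)$ with $f\circ\langle 1_A,\mathbf{fix}^X_A(f)\rangle=\mathbf{fix}^X_A(f)$ for all $f:A\times X\to X$, and $\mathbf{fix}^X_B(f)\circ g=\mathbf{fix}^X_A(f\circ(g\times 1_X))$ for all $g:A\to B$, $f:B\times X\to X$. A Cartesian differential fixpoint category is a Cartesian differential category with a parametrized fixpoint operator satisfying the differential-fixpoint rule: for every $f:A\times X\to X$, $\mathbf{D}[\mathbf{fix}^X_A(f)]=\pi_2\circ\mathbf{fix}^{\mathbf{T}X}_{\mathbf{T}A}(\mathbf{T}(f)\circ c)$. A bifree $G$-algebra for an endofunctor $G$ is an initial $G$-algebra $(\Phi,w:G\Phi\to\Phi)$ such that $(\Phi,w^{-1}:\Phi\to G\Phi)$ is a final $G$-coalgebra. The functor $\mathrm{J}$ is the identity on objects and sends $g:A\to B$ to $g\circ\varepsilon_A:FA\to B$; products in $\mathbb{C}_F$ are computed as in $\mathbb{C}$, and $\mathrm{J}$ preserves them strictly. Construction of $\mathbf{fix}$ (Simpson–Plotkin, known): let $w_A:F(A\times\Phi_A)\to\Phi_A$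 be a bifree algebra of $F(A\times -)$, viewed as a map $A\times\Phi_A\to\Phi_A$ in $\mathbb{C}_F$. There is a unique map $t_A:A\to\Phi_A$ in $\mathbb{C}_F$ with $w_A\circ\langle 1_A,t_A\rangle=t_A$, and for every $f:A\times X\to X$ in $\mathbb{C}_F$ a unique map $u_f:\Phi_A\to X$ in $\mathbb{C}$ with $\mathrm{J}(u_f)\circ w_A=f\circ\mathrm{J}(1_A\times u_f)$ in $\mathbb{C}_F$. Then $\mathbf{fix}^X_A(f):=\mathrm{J}(u_f)\circ t_A$ is a parametrized fixpoint operator on $\mathbb{C}_F$, and it is the unique one that is $\mathrm{J}$-uniform, i.e. such that for every $h:X\to Y$ in $\mathbb{C}$, and $f:A\times X\to X$, $g:A\times Y\to Y$ in $\mathbb{C}_F$ with $\mathrm{J}(h)\circ f=g\circ(1_A\times\mathrm{J}(h))$, one has $\mathrm{J}(h)\circ\mathbf{fix}^X_A(f)=\mathbf{fix}^Y_A(g)$. *)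

theory Defs
  imports Main
begin

section \<open>Categories with finite products\<close>

text \<open>
  Categories have explicit sets of objects and arrows; every arrow has one domain and one codomain,
  and composition is relevant only for composable arrows. Finite products are given by a
  chosen terminal object and chosen binary products; longer products are iterated binary ones,
  and a fourfold tuple on an object of the form \<open>(A \<times> B) \<times> (C \<times> D)\<close> is a pair of pairs.
\<close>

record ('o, 'm) category_data =
  Obj :: "'o set"
  Arr :: "'m set"
  Dom :: "'m \<Rightarrow> 'o"
  Cod :: "'m \<Rightarrow> 'o"
  Idt :: "'o \<Rightarrow> 'm" ("\<one>\<index>")
  Comp :: "'m \<Rightarrow> 'm \<Rightarrow> 'm" (infixr "\<cdot>\<index>" 70)

record ('o, 'm) cartesian_data = "('o, 'm) category_data" +
  Top :: "'o"
  Prod :: "'o \<Rightarrow> 'o \<Rightarrow> 'o" (infixr "\<otimes>\<index>" 75)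
  Proj1 :: "'o \<Rightarrow> 'o \<Rightarrow> 'm" ("\<pi>\<^sub>1\<index>")
  Proj2 :: "'o \<Rightarrow> 'o \<Rightarrow> 'm" ("\<pi>\<^sub>2\<index>")
  Tuple :: "'m \<Rightarrow> 'm \<Rightarrow> 'm" ("(\<langle>_,/ _\<rangle>\<index>)")

definition hom :: "('o, 'm, 'z) category_data_scheme \<Rightarrow> 'o \<Rightarrow> 'o \<Rightarrow> 'm set" where
  "hom C A B = {f \<in> Arr C. Dom C f = A \<and> Cod C f = B}"

locale category =
  fixes C :: "('o, 'm, 'z) category_data_scheme" (structure)
  assumes Dom_Obj: "f \<in> Arr C \<Longrightarrow> Dom C f \<in> Obj C"
    and Cod_Obj: "f \<in> Arr C \<Longrightarrow> Cod C f \<in> Obj C"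
    and Idt_hom: "A \<in> Obj C \<Longrightarrow> \<one> A \<in> hom C A A"
    and Comp_hom: "f \<in> hom C X Y \<Longrightarrow> g \<in> hom C Y Z \<Longrightarrow> g \<cdot> f \<in> hom C X Z"
    and Comp_Idt: "f \<in> hom C X Y \<Longrightarrow> f \<cdot> \<one> X = f"
    and Idt_Comp: "f \<in> hom C X Y \<Longrightarrow> \<one> Y \<cdot> f = f"
    and Comp_assoc: "f \<in> hom C W X \<Longrightarrow> g \<in> hom C X Y \<Longrightarrow> h \<in> hom C Y Z
      \<Longrightarrow> (h \<cdot> g) \<cdot> f = h \<cdot> (g \<cdot> f)"

locale cartesian_category = category C
  for C :: "('o, 'm, 'z) cartesian_data_scheme" (structure) +
  assumes Top_Obj: "Top C \<in> Obj C"
    and Top_terminal: "A \<in> Obj C \<Longrightarrow> \<exists>!f. f \<in> hom C A (Top C)"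
    and Prod_Obj: "A \<in> Obj C \<Longrightarrow> B \<in> Obj C \<Longrightarrow> A \<otimes> B \<in> Obj C"
    and Proj1_hom: "A \<in> Obj C \<Longrightarrow> B \<in> Obj C \<Longrightarrow> \<pi>\<^sub>1 A B \<in> hom C (A \<otimes> B) A"
    and Proj2_hom: "A \<in> Obj C \<Longrightarrow> B \<in> Obj C \<Longrightarrow> \<pi>\<^sub>2 A B \<in> hom C (A \<otimes> B) B"
    and Tuple_hom: "f \<in> hom C X A \<Longrightarrow> g \<in> hom C X B \<Longrightarrow> \<langle>f, g\<rangle> \<in> hom C X (A \<otimes> B)"
    and Proj1_Tuple: "f \<in> hom C X A \<Longrightarrow> g \<in> hom C X B \<Longrightarrow> \<pi>\<^sub>1 A B \<cdot> \<langle>f, g\<rangle> = f"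
    and Proj2_Tuple: "f \<in> hom C X A \<Longrightarrow> g \<in> hom C X B \<Longrightarrow> \<pi>\<^sub>2 A B \<cdot> \<langle>f, g\<rangle> = g"
    and Tuple_unique: "A \<in> Obj C \<Longrightarrow> B \<in> Obj C \<Longrightarrow> h \<in> hom C X (A \<otimes> B)
      \<Longrightarrow> \<langle>\<pi>\<^sub>1 A B \<cdot> h, \<pi>\<^sub>2 A B \<cdot> h\<rangle> = h"

definition prod_map :: "('o, 'm, 'z) cartesian_data_scheme \<Rightarrow> 'm \<Rightarrow> 'm \<Rightarrow> 'm" where
  "prod_map C f g =
    \<langle>f \<cdot>\<^bsub>C\<^esub> \<pi>\<^sub>1\<^bsub>C\<^esub> (Dom C f) (Dom C g), g \<cdot>\<^bsub>C\<^esub> \<pi>\<^sub>2\<^bsub>C\<^esub> (Dom C f) (Dom C g)\<rangle>\<^bsub>C\<^esub>"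

text \<open>The interchange \<open>(A \<times> B) \<times> (C \<times> D) \<rightarrow> (A \<times> C) \<times> (B \<times> D)\<close>.\<close>

definition interchange ::
  "('o, 'm, 'z) cartesian_data_scheme \<Rightarrow> 'o \<Rightarrow> 'o \<Rightarrow> 'o \<Rightarrow> 'o \<Rightarrow> 'm" where
  "interchange K A B C D =
    (let p = \<pi>\<^sub>1\<^bsub>K\<^esub> (A \<otimes>\<^bsub>K\<^esub> B) (C \<otimes>\<^bsub>K\<^esub> D); q = \<pi>\<^sub>2\<^bsub>K\<^esub> (A \<otimes>\<^bsub>K\<^esub> B) (C \<otimes>\<^bsub>K\<^esub> D) in
     \<langle>\<langle>\<pi>\<^sub>1\<^bsub>K\<^esub> A B \<cdot>\<^bsub>K\<^esub> p, \<pi>\<^sub>1\<^bsub>K\<^esub> C D \<cdot>\<^bsub>K\<^esub> q\<rangle>\<^bsub>K\<^esub>,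
      \<langle>\<pi>\<^sub>2\<^bsub>K\<^esub> A B \<cdot>\<^bsub>K\<^esub> p, \<pi>\<^sub>2\<^bsub>K\<^esub> C D \<cdot>\<^bsub>K\<^esub> q\<rangle>\<^bsub>K\<^esub>\<rangle>\<^bsub>K\<^esub>)"


section \<open>Endofunctors, comonads and co-Kleisli categories\<close>

record ('o, 'm) endofunctor_data =
  FObj :: "'o \<Rightarrow> 'o"
  FMap :: "'m \<Rightarrow> 'm"

record ('o, 'm) comonad_data = "('o, 'm) endofunctor_data" +
  Comult :: "'o \<Rightarrow> 'm" ("\<delta>\<index>")
  Counit :: "'o \<Rightarrow> 'm" ("\<epsilon>\<index>")

locale endofunctor = category C
  for C :: "('o, 'm, 'z) category_data_scheme"
    and F :: "('o, 'm, 'y) endofunctor_data_scheme" +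
  assumes FObj_Obj: "A \<in> Obj C \<Longrightarrow> FObj F A \<in> Obj C"
    and FMap_hom: "f \<in> hom C A B \<Longrightarrow> FMap F f \<in> hom C (FObj F A) (FObj F B)"
    and FMap_Idt: "A \<in> Obj C \<Longrightarrow> FMap F (\<one>\<^bsub>C\<^esub> A) = \<one>\<^bsub>C\<^esub> (FObj F A)"
    and FMap_Comp: "f \<in> hom C X Y \<Longrightarrow> g \<in> hom C Y Z
      \<Longrightarrow> FMap F (g \<cdot>\<^bsub>C\<^esub> f) = FMap F g \<cdot>\<^bsub>C\<^esub> FMap F f"

locale comonad = endofunctor C F
  for C :: "('o, 'm, 'z) category_data_scheme"
    and F :: "('o, 'm, 'y) comonad_data_scheme" +
  assumes Comult_hom: "A \<in> Obj C \<Longrightarrow> \<delta>\<^bsub>F\<^esub> A \<in> hom C (FObj F A) (FObj F (FObj F A))"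
    and Counit_hom: "A \<in> Obj C \<Longrightarrow> \<epsilon>\<^bsub>F\<^esub> A \<in> hom C (FObj F A) A"
    and Comult_natural: "f \<in> hom C A B
      \<Longrightarrow> FMap F (FMap F f) \<cdot>\<^bsub>C\<^esub> \<delta>\<^bsub>F\<^esub> A = \<delta>\<^bsub>F\<^esub> B \<cdot>\<^bsub>C\<^esub> FMap F f"
    and Counit_natural: "f \<in> hom C A B \<Longrightarrow> \<epsilon>\<^bsub>F\<^esub> B \<cdot>\<^bsub>C\<^esub> FMap F f = f \<cdot>\<^bsub>C\<^esub> \<epsilon>\<^bsub>F\<^esub> A"
    and Counit_Comult: "A \<in> Obj C \<Longrightarrow> \<epsilon>\<^bsub>F\<^esub> (FObj F A) \<cdot>\<^bsub>C\<^esub> \<delta>\<^bsub>F\<^esub> A = \<one>\<^bsub>C\<^esub> (FObj F A)"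
    and FMap_Counit_Comult: "A \<in> Obj C
      \<Longrightarrow> FMap F (\<epsilon>\<^bsub>F\<^esub> A) \<cdot>\<^bsub>C\<^esub> \<delta>\<^bsub>F\<^esub> A = \<one>\<^bsub>C\<^esub> (FObj F A)"
    and Comult_coassoc: "A \<in> Obj C
      \<Longrightarrow> \<delta>\<^bsub>F\<^esub> (FObj F A) \<cdot>\<^bsub>C\<^esub> \<delta>\<^bsub>F\<^esub> A = FMap F (\<delta>\<^bsub>F\<^esub> A) \<cdot>\<^bsub>C\<^esub> \<delta>\<^bsub>F\<^esub> A"

text \<open>
  An arrow \<open>A \<rightarrow> B\<close> of the co-Kleisli category is a pair \<open>(A, f)\<close> with \<open>f : F A \<rightarrow> B\<close>; the object
  \<open>A\<close> is recorded because it cannot be recovered from \<open>F A\<close>.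
\<close>

definition coKleisli ::
  "('o, 'm, 'z) cartesian_data_scheme \<Rightarrow> ('o, 'm, 'y) comonad_data_scheme
    \<Rightarrow> ('o, 'o \<times> 'm) cartesian_data" where
  "coKleisli C F = \<lparr>
     Obj = Obj C,
     Arr = {(A, f). A \<in> Obj C \<and> f \<in> Arr C \<and> Dom C f = FObj F A},
     Dom = fst,
     Cod = (\<lambda>f. Cod C (snd f)),
     Idt = (\<lambda>A. (A, \<epsilon>\<^bsub>F\<^esub> A)),
     Comp = (\<lambda>g f. (fst f, snd g \<cdot>\<^bsub>C\<^esub> FMap F (snd f) \<cdot>\<^bsub>C\<^esub> \<delta>\<^bsub>F\<^esub> (fst f))),
     Top = Top C,
     Prod = Prod C,
     Proj1 = (\<lambda>A B. (A \<otimes>\<^bsub>C\<^esub> B, \<pi>\<^sub>1\<^bsub>C\<^esub> A B \<cdot>\<^bsub>C\<^esub> \<epsilon>\<^bsub>F\<^esub> (A \<otimes>\<^bsub>C\<^esub> B))),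
     Proj2 = (\<lambda>A B. (A \<otimes>\<^bsub>C\<^esub> B, \<pi>\<^sub>2\<^bsub>C\<^esub> A B \<cdot>\<^bsub>C\<^esub> \<epsilon>\<^bsub>F\<^esub> (A \<otimes>\<^bsub>C\<^esub> B))),
     Tuple = (\<lambda>f g. (fst f, \<langle>snd f, snd g\<rangle>\<^bsub>C\<^esub>)) \<rparr>"

text \<open>The free functor \<open>J\<close> on arrows; it is the identity on objects.\<close>

definition free_map ::
  "('o, 'm, 'z) category_data_scheme \<Rightarrow> ('o, 'm, 'y) comonad_data_scheme \<Rightarrow> 'm \<Rightarrow> 'o \<times> 'm" where
  "free_map C F g = (Dom C g, g \<cdot>\<^bsub>C\<^esub> \<epsilon>\<^bsub>F\<^esub> (Dom C g))"


section \<open>Bifree algebras\<close>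

definition initial_algebra ::
  "('o, 'm, 'z) category_data_scheme \<Rightarrow> ('o, 'm, 'y) endofunctor_data_scheme \<Rightarrow> 'o \<Rightarrow> 'm \<Rightarrow> bool"
where
  "initial_algebra C G \<Phi> w \<longleftrightarrow>
    \<Phi> \<in> Obj C \<and> w \<in> hom C (FObj G \<Phi>) \<Phi> \<and>
    (\<forall>X\<in>Obj C. \<forall>x\<in>hom C (FObj G X) X.
      \<exists>!u. u \<in> hom C \<Phi> X \<and> u \<cdot>\<^bsub>C\<^esub> w = x \<cdot>\<^bsub>C\<^esub> FMap G u)"

definition final_coalgebra ::
  "('o, 'm, 'z) category_data_scheme \<Rightarrow> ('o, 'm, 'y) endofunctor_data_scheme \<Rightarrow> 'o \<Rightarrow> 'm \<Rightarrow> bool"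
where
  "final_coalgebra C G \<Phi> v \<longleftrightarrow>
    \<Phi> \<in> Obj C \<and> v \<in> hom C \<Phi> (FObj G \<Phi>) \<and>
    (\<forall>X\<in>Obj C. \<forall>x\<in>hom C X (FObj G X).
      \<exists>!u. u \<in> hom C X \<Phi> \<and> v \<cdot>\<^bsub>C\<^esub> u = FMap G u \<cdot>\<^bsub>C\<^esub> x)"

definition bifree_algebra ::
  "('o, 'm, 'z) category_data_scheme \<Rightarrow> ('o, 'm, 'y) endofunctor_data_scheme \<Rightarrow> 'o \<Rightarrow> 'm \<Rightarrow> bool"
where
  "bifree_algebra C G \<Phi> w \<longleftrightarrow>
    initial_algebra C G \<Phi> w \<and>
    (\<exists>v. v \<in> hom C \<Phi> (FObj G \<Phi>) \<and> v \<cdot>\<^bsub>C\<^esub> w = \<one>\<^bsub>C\<^esub> (FObj G \<Phi>) \<and> w \<cdot>\<^bsub>C\<^esub> v = \<one>\<^bsub>C\<^esub> \<Phi> \<and>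
      final_coalgebra C G \<Phi> v)"

definition times_functor ::
  "('o, 'm, 'z) cartesian_data_scheme \<Rightarrow> ('o, 'm, 'y) endofunctor_data_scheme \<Rightarrow> 'o
    \<Rightarrow> ('o, 'm) endofunctor_data" where
  "times_functor C F A = \<lparr>
     FObj = (\<lambda>X. FObj F (A \<otimes>\<^bsub>C\<^esub> X)),
     FMap = (\<lambda>f. FMap F (prod_map C (\<one>\<^bsub>C\<^esub> A) f)) \<rparr>"


section \<open>Cartesian differential categories\<close>

text \<open>
  \<open>zero A B\<close> is the zero of the hom-monoid from \<open>A\<close> to \<open>B\<close>; \<open>add\<close> is only relevant
  for parallel arrows.
\<close>

locale left_additive_category = category K
  for K :: "('o, 'm, 'z) category_data_scheme" (structure)
    and zero :: "'o \<Rightarrow> 'o \<Rightarrow> 'm" and add :: "'m \<Rightarrow> 'm \<Rightarrow> 'm" +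
  assumes zero_hom: "A \<in> Obj K \<Longrightarrow> B \<in> Obj K \<Longrightarrow> zero A B \<in> hom K A B"
    and add_hom: "f \<in> hom K A B \<Longrightarrow> g \<in> hom K A B \<Longrightarrow> add f g \<in> hom K A B"
    and add_assoc: "f \<in> hom K A B \<Longrightarrow> g \<in> hom K A B \<Longrightarrow> h \<in> hom K A B
      \<Longrightarrow> add (add f g) h = add f (add g h)"
    and add_commute: "f \<in> hom K A B \<Longrightarrow> g \<in> hom K A B \<Longrightarrow> add f g = add g f"
    and add_zero: "f \<in> hom K A B \<Longrightarrow> add f (zero A B) = f"
    and add_Comp: "x \<in> hom K X A \<Longrightarrow> f \<in> hom K A B \<Longrightarrow> g \<in> hom K A B
      \<Longrightarrow> add f g \<cdot> x = add (f \<cdot> x) (g \<cdot> x)"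
    and zero_Comp: "x \<in> hom K X A \<Longrightarrow> B \<in> Obj K \<Longrightarrow> zero A B \<cdot> x = zero X B"

definition additive_map ::
  "('o, 'm, 'z) category_data_scheme \<Rightarrow> ('o \<Rightarrow> 'o \<Rightarrow> 'm) \<Rightarrow> ('m \<Rightarrow> 'm \<Rightarrow> 'm) \<Rightarrow> 'm \<Rightarrow> bool" where
  "additive_map K zero add f \<longleftrightarrow> f \<in> Arr K \<and>
    (\<forall>X\<in>Obj K. f \<cdot>\<^bsub>K\<^esub> zero X (Dom K f) = zero X (Cod K f) \<and>
      (\<forall>x\<in>hom K X (Dom K f). \<forall>y\<in>hom K X (Dom K f).
        f \<cdot>\<^bsub>K\<^esub> add x y = add (f \<cdot>\<^bsub>K\<^esub> x) (f \<cdot>\<^bsub>K\<^esub> y)))"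

locale cartesian_left_additive_category =
  left_additive_category K zero add + cartesian_category K
  for K :: "('o, 'm, 'z) cartesian_data_scheme" (structure)
    and zero :: "'o \<Rightarrow> 'o \<Rightarrow> 'm" and add :: "'m \<Rightarrow> 'm \<Rightarrow> 'm" +
  assumes Proj1_additive: "A \<in> Obj K \<Longrightarrow> B \<in> Obj K \<Longrightarrow> additive_map K zero add (\<pi>\<^sub>1 A B)"
    and Proj2_additive: "A \<in> Obj K \<Longrightarrow> B \<in> Obj K \<Longrightarrow> additive_map K zero add (\<pi>\<^sub>2 A B)"

locale cartesian_differential_category = cartesian_left_additive_category K zero add
  for K :: "('o, 'm, 'z) cartesian_data_scheme" (structure)
    and zero :: "'o \<Rightarrow> 'o \<Rightarrow> 'm" and add :: "'m \<Rightarrow> 'm \<Rightarrow> 'm" and D :: "'m \<Rightarrow> 'm" +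
  assumes D_hom: "f \<in> hom K A B \<Longrightarrow> D f \<in> hom K (A \<otimes> A) B"
    and CD1_zero: "A \<in> Obj K \<Longrightarrow> B \<in> Obj K \<Longrightarrow> D (zero A B) = zero (A \<otimes> A) B"
    and CD1_add: "f \<in> hom K A B \<Longrightarrow> g \<in> hom K A B \<Longrightarrow> D (add f g) = add (D f) (D g)"
    and CD2_zero: "f \<in> hom K A B \<Longrightarrow> x \<in> hom K X A \<Longrightarrow> D f \<cdot> \<langle>x, zero X A\<rangle> = zero X B"
    and CD2_add: "f \<in> hom K A B \<Longrightarrow> x \<in> hom K X A \<Longrightarrow> y \<in> hom K X A \<Longrightarrow> z \<in> hom K X A
      \<Longrightarrow> D f \<cdot> \<langle>x, add y z\<rangle> = add (D f \<cdot> \<langle>x, y\<rangle>) (D f \<cdot> \<langle>x, z\<rangle>)"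
    and CD3_Idt: "A \<in> Obj K \<Longrightarrow> D (\<one> A) = \<pi>\<^sub>2 A A"
    and CD3_Proj1: "A \<in> Obj K \<Longrightarrow> B \<in> Obj K
      \<Longrightarrow> D (\<pi>\<^sub>1 A B) = \<pi>\<^sub>1 A B \<cdot> \<pi>\<^sub>2 (A \<otimes> B) (A \<otimes> B)"
    and CD3_Proj2: "A \<in> Obj K \<Longrightarrow> B \<in> Obj K
      \<Longrightarrow> D (\<pi>\<^sub>2 A B) = \<pi>\<^sub>2 A B \<cdot> \<pi>\<^sub>2 (A \<otimes> B) (A \<otimes> B)"
    and CD4: "f \<in> hom K X A \<Longrightarrow> g \<in> hom K X B \<Longrightarrow> D \<langle>f, g\<rangle> = \<langle>D f, D g\<rangle>"
    and CD5: "f \<in> hom K X Y \<Longrightarrow> g \<in> hom K Y Z \<Longrightarrow> D (g \<cdot> f) = D g \<cdot> \<langle>f \<cdot> \<pi>\<^sub>1 X X, D f\<rangle>"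
    and CD6: "f \<in> hom K A B \<Longrightarrow> x \<in> hom K X A \<Longrightarrow> y \<in> hom K X A \<Longrightarrow> z \<in> hom K X A
      \<Longrightarrow> D (D f) \<cdot> \<langle>\<langle>x, y\<rangle>, \<langle>zero X A, z\<rangle>\<rangle> = D f \<cdot> \<langle>x, z\<rangle>"
    and CD7: "f \<in> hom K A B \<Longrightarrow> x \<in> hom K X A \<Longrightarrow> y \<in> hom K X A \<Longrightarrow> z \<in> hom K X A
      \<Longrightarrow> D (D f) \<cdot> \<langle>\<langle>x, y\<rangle>, \<langle>z, zero X A\<rangle>\<rangle> = D (D f) \<cdot> \<langle>\<langle>x, z\<rangle>, \<langle>y, zero X A\<rangle>\<rangle>"

definition linear_map :: "('o, 'm, 'z) cartesian_data_scheme \<Rightarrow> ('m \<Rightarrow> 'm) \<Rightarrow> 'm \<Rightarrow> bool" where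
  "linear_map K D f \<longleftrightarrow> f \<in> Arr K \<and> D f = f \<cdot>\<^bsub>K\<^esub> \<pi>\<^sub>2\<^bsub>K\<^esub> (Dom K f) (Dom K f)"

definition tangent_obj :: "('o, 'm, 'z) cartesian_data_scheme \<Rightarrow> 'o \<Rightarrow> 'o" where
  "tangent_obj K A = A \<otimes>\<^bsub>K\<^esub> A"

definition tangent_map :: "('o, 'm, 'z) cartesian_data_scheme \<Rightarrow> ('m \<Rightarrow> 'm) \<Rightarrow> 'm \<Rightarrow> 'm" where
  "tangent_map K D f = \<langle>f \<cdot>\<^bsub>K\<^esub> \<pi>\<^sub>1\<^bsub>K\<^esub> (Dom K f) (Dom K f), D f\<rangle>\<^bsub>K\<^esub>"


section \<open>Parametrized fixpoint operators\<close>

text \<open>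
  \<open>fixp A X f\<close> is defined for \<open>f : A \<times> X \<rightarrow> X\<close>; both objects are arguments because
  they are not determined by \<open>A \<times> X\<close>.
\<close>

locale parametrized_fixpoint_operator = cartesian_category K
  for K :: "('o, 'm, 'z) cartesian_data_scheme" (structure)
    and fixp :: "'o \<Rightarrow> 'o \<Rightarrow> 'm \<Rightarrow> 'm" +
  assumes fixp_hom: "A \<in> Obj K \<Longrightarrow> X \<in> Obj K \<Longrightarrow> f \<in> hom K (A \<otimes> X) X
      \<Longrightarrow> fixp A X f \<in> hom K A X"
    and fixp_fixpoint: "A \<in> Obj K \<Longrightarrow> X \<in> Obj K \<Longrightarrow> f \<in> hom K (A \<otimes> X) X
      \<Longrightarrow> f \<cdot> \<langle>\<one> A, fixp A X f\<rangle> = fixp A X f"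
    and fixp_natural: "X \<in> Obj K \<Longrightarrow> g \<in> hom K A B \<Longrightarrow> f \<in> hom K (B \<otimes> X) X
      \<Longrightarrow> fixp B X f \<cdot> g = fixp A X (f \<cdot> prod_map K g (\<one> X))"

locale cartesian_differential_fixpoint_category =
  cartesian_differential_category K zero add D + parametrized_fixpoint_operator K fixp
  for K :: "('o, 'm, 'z) cartesian_data_scheme" (structure)
    and zero :: "'o \<Rightarrow> 'o \<Rightarrow> 'm" and add :: "'m \<Rightarrow> 'm \<Rightarrow> 'm" and D :: "'m \<Rightarrow> 'm"
    and fixp :: "'o \<Rightarrow> 'o \<Rightarrow> 'm \<Rightarrow> 'm" +
  assumes differential_fixpoint: "A \<in> Obj K \<Longrightarrow> X \<in> Obj K \<Longrightarrow> f \<in> hom K (A \<otimes> X) X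
      \<Longrightarrow> D (fixp A X f) =
        \<pi>\<^sub>2 X X \<cdot> fixp (tangent_obj K A) (tangent_obj K X) (tangent_map K D f \<cdot> interchange K A A X X)"

definition tangent_fixpoint_rule ::
  "('o, 'm, 'z) cartesian_data_scheme \<Rightarrow> ('m \<Rightarrow> 'm) \<Rightarrow> ('o \<Rightarrow> 'o \<Rightarrow> 'm \<Rightarrow> 'm) \<Rightarrow> bool" where
  "tangent_fixpoint_rule K D fixp \<longleftrightarrow>
    (\<forall>A\<in>Obj K. \<forall>X\<in>Obj K. \<forall>f\<in>hom K (A \<otimes>\<^bsub>K\<^esub> X) X.
      tangent_map K D (fixp A X f) =
        fixp (tangent_obj K A) (tangent_obj K X) (tangent_map K D f \<cdot>\<^bsub>K\<^esub> interchange K A A X X))"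


section \<open>The fixpoint operator induced by bifree algebras\<close>

text \<open>
  For each object \<open>A\<close>, \<open>w A : F (A \<times> \<Phi> A) \<rightarrow> \<Phi> A\<close> is a bifree algebra of \<open>F (A \<times> -)\<close>;
  \<open>bifree_map\<close> is the same map regarded as \<open>A \<times> \<Phi> A \<rightarrow> \<Phi> A\<close> in the co-Kleisli category.
  The definite descriptions below denote the maps \<open>t\<^sub>A\<close> and \<open>u\<^sub>f\<close>, which exist uniquely
  whenever the \<open>w A\<close> are bifree.
\<close>

definition bifree_map ::
  "('o, 'm, 'z) cartesian_data_scheme \<Rightarrow> ('o \<Rightarrow> 'o) \<Rightarrow> ('o \<Rightarrow> 'm) \<Rightarrow> 'o \<Rightarrow> 'o \<times> 'm" where
  "bifree_map C \<Phi> w A = (A \<otimes>\<^bsub>C\<^esub> \<Phi> A, w A)"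

definition bifree_point ::
  "('o, 'm, 'z) cartesian_data_scheme \<Rightarrow> ('o, 'm, 'y) comonad_data_scheme
    \<Rightarrow> ('o \<Rightarrow> 'o) \<Rightarrow> ('o \<Rightarrow> 'm) \<Rightarrow> 'o \<Rightarrow> 'o \<times> 'm" where
  "bifree_point C F \<Phi> w A =
    (THE t. t \<in> hom (coKleisli C F) A (\<Phi> A) \<and>
      bifree_map C \<Phi> w A \<cdot>\<^bsub>coKleisli C F\<^esub>
        \<langle>\<one>\<^bsub>coKleisli C F\<^esub> A, t\<rangle>\<^bsub>coKleisli C F\<^esub> = t)"

definition bifree_fold ::
  "('o, 'm, 'z) cartesian_data_scheme \<Rightarrow> ('o, 'm, 'y) comonad_data_scheme
    \<Rightarrow> ('o \<Rightarrow> 'o) \<Rightarrow> ('o \<Rightarrow> 'm) \<Rightarrow> 'o \<Rightarrow> 'o \<Rightarrow> 'o \<times> 'm \<Rightarrow> 'm" where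
  "bifree_fold C F \<Phi> w A X f =
    (THE u. u \<in> hom C (\<Phi> A) X \<and>
      free_map C F u \<cdot>\<^bsub>coKleisli C F\<^esub> bifree_map C \<Phi> w A =
        f \<cdot>\<^bsub>coKleisli C F\<^esub> free_map C F (prod_map C (\<one>\<^bsub>C\<^esub> A) u))"

definition bifree_fixp ::
  "('o, 'm, 'z) cartesian_data_scheme \<Rightarrow> ('o, 'm, 'y) comonad_data_scheme
    \<Rightarrow> ('o \<Rightarrow> 'o) \<Rightarrow> ('o \<Rightarrow> 'm) \<Rightarrow> 'o \<Rightarrow> 'o \<Rightarrow> 'o \<times> 'm \<Rightarrow> 'o \<times> 'm" where
  "bifree_fixp C F \<Phi> w A X f =
    free_map C F (bifree_fold C F \<Phi> w A X f) \<cdot>\<^bsub>coKleisli C F\<^esub> bifree_point C F \<Phi> w A"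

end

theory Submission
  imports Defs
begin

text \<open>
  Write \<open>K\<close> for the co-Kleisli category, \<open>t : A \<rightarrow> \<Phi>\<close> for the fixpoint of the bifree map
  \<open>w : A \<times> \<Phi> \<rightarrow> \<Phi>\<close>, and evaluate maps at generalized elements. By \<open>J\<close>-uniformity
  (\<open>fixp_uniform\<close>) the rule for an arbitrary \<open>f\<close> follows from the rule for \<open>w\<close>
  (\<open>fixp_tangent_w\<close>), because the fold of \<open>f\<close> is linear. For \<open>w\<close> the fixpoint of the tangent map is
  triangular: its first component is \<open>t a\<close>, and by a Bekic identity (\<open>fixp_triangular\<close>) its second
  component is the chosen fixpoint, in the unknown \<open>y\<close>, of
  \<open>y = D[w]((a, t a), (b, y))\<close>. By the chain rule \<open>D[t](a, b)\<close> solves the same equation, and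
  the difficulty is uniqueness: finality gives it for equations \<open>x = w(g, x)\<close>, but not directly for
  the differentiated equation.

  Two consequences of finality repair this. They come from coalgebras built with the derivative of the
  universal map \<open>\<eta> : X \<rightarrow> F X\<close> of \<open>K\<close>: a linear map \<open>s\<close> out of \<open>F X\<close> satisfies
  \<open>s \<circ> D[\<eta>] = D[s \<circ> \<eta>]\<close>, so such coalgebras encode equations that involve derivatives.

  First, \<open>x = D[w]((a, 0), (b, x))\<close> has a unique solution (\<open>w_derivative_solution_unique\<close>); the
  base point \<open>0\<close> is available because linear maps preserve it. Hence a fixpoint of an
  equation linear in \<open>(b, y)\<close> is well behaved: its fold \<open>u\<close> intertwines the equation not only with the
  bifree map but also with the linearization of the bifree map at \<open>0\<close>, so by uniformity the
  chosen fixpoint is the image under \<open>u\<close> of a unique solution. This shows that the chosen \<open>y\<close> vanishes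
  for \<open>b = 0\<close> and equals its own derivative at \<open>b = 0\<close> (\<open>fixp_derivative_eqn\<close>).

  Second, there is exactly one \<open>h : A \<times> A \<rightarrow> \<Phi>\<close> which solves the fixpoint equation of \<open>w\<close> to first
  order in \<open>b\<close> (\<open>w_first_order_solution_unique\<close>). If \<open>y\<close> solves the differentiated
  equation, vanishes at \<open>b = 0\<close> and is its own derivative there, then \<open>h(a, b) = t a + y(a, b)\<close> is such
  an \<open>h\<close>, and \<open>y\<close> is recovered from \<open>h\<close> by differentiating at \<open>b = 0\<close>. Both \<open>D[t]\<close> and the chosen
  fixpoint have these properties, so they agree (\<open>D_point\<close>).

  The argument is carried out in a locale which mentions only \<open>K\<close>, its class \<open>S\<close> of maps \<open>J(g)\<close>, and the
  translation of initiality and finality to \<open>K\<close>; the last two sections supply an instance.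
\<close>

section \<open>Calculating in a Cartesian differential category\<close>

lemma hom_iff: "f \<in> hom C A B \<longleftrightarrow> f \<in> Arr C \<and> Dom C f = A \<and> Cod C f = B"
  by (auto simp: hom_def)

context category
begin

lemma Comp_arr [simp]:
  assumes "f \<in> Arr C" "g \<in> Arr C" "Dom C g = Cod C f"
  shows "g \<cdot> f \<in> Arr C" "Dom C (g \<cdot> f) = Dom C f" "Cod C (g \<cdot> f) = Cod C g"
  using Comp_hom[of f "Dom C f" "Cod C f" g "Cod C g"] assms by (auto simp: hom_def)

lemma Idt_arr [simp]:
  assumes "A \<in> Obj C"
  shows "\<one> A \<in> Arr C" "Dom C (\<one> A) = A" "Cod C (\<one> A) = A"
  using Idt_hom[OF assms] by (auto simp: hom_def)

lemma arr_Obj [simp]: "f \<in> Arr C \<Longrightarrow> Dom C f \<in> Obj C" "f \<in> Arr C \<Longrightarrow> Cod C f \<in> Obj C"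
  by (auto intro: Dom_Obj Cod_Obj)

lemma Comp_Idt_arr [simp]: "f \<in> Arr C \<Longrightarrow> Dom C f = A \<Longrightarrow> f \<cdot> \<one> A = f"
  using Comp_Idt[of f A "Cod C f"] by (auto simp: hom_def)

lemma Idt_Comp_arr [simp]: "f \<in> Arr C \<Longrightarrow> Cod C f = A \<Longrightarrow> \<one> A \<cdot> f = f"
  using Idt_Comp[of f "Dom C f" A] by (auto simp: hom_def)

lemma Comp_assoc_arr [simp]:
  assumes "f \<in> Arr C" "g \<in> Arr C" "h \<in> Arr C" "Dom C g = Cod C f" "Dom C h = Cod C g"
  shows "(h \<cdot> g) \<cdot> f = h \<cdot> (g \<cdot> f)"
  using assms by (intro Comp_assoc[of _ "Dom C f" "Cod C f" _ "Cod C g" _ "Cod C h"]) (auto simp: hom_def)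

end

context cartesian_category
begin

lemmas Prod_Obj [simp]

lemma Proj_arr [simp]:
  assumes "A \<in> Obj C" "B \<in> Obj C"
  shows "\<pi>\<^sub>1 A B \<in> Arr C" "Dom C (\<pi>\<^sub>1 A B) = A \<otimes> B" "Cod C (\<pi>\<^sub>1 A B) = A"
    "\<pi>\<^sub>2 A B \<in> Arr C" "Dom C (\<pi>\<^sub>2 A B) = A \<otimes> B" "Cod C (\<pi>\<^sub>2 A B) = B"
  using Proj1_hom[OF assms] Proj2_hom[OF assms] by (auto simp: hom_def)

lemma Tuple_arr [simp]:
  assumes "f \<in> Arr C" "g \<in> Arr C" "Dom C f = Dom C g"
  shows "\<langle>f, g\<rangle> \<in> Arr C" "Dom C \<langle>f, g\<rangle> = Dom C g" "Cod C \<langle>f, g\<rangle> = Cod C f \<otimes> Cod C g"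
  using Tuple_hom[of f "Dom C g" "Cod C f" g "Cod C g"] assms by (auto simp: hom_def)

lemma Proj_Tuple_arr [simp]:
  assumes "f \<in> Arr C" "g \<in> Arr C" "Dom C f = Dom C g" "Cod C f = A" "Cod C g = B"
  shows "\<pi>\<^sub>1 A B \<cdot> \<langle>f, g\<rangle> = f" "\<pi>\<^sub>2 A B \<cdot> \<langle>f, g\<rangle> = g"
  using Proj1_Tuple[of f "Dom C g" A g B] Proj2_Tuple[of f "Dom C g" A g B] assms
  by (auto simp: hom_def)

lemma Tuple_eqI:
  assumes "h \<in> Arr C" "k \<in> Arr C" "Cod C h = A \<otimes> B" "Cod C k = A \<otimes> B" "A \<in> Obj C" "B \<in> Obj C"
    and "\<pi>\<^sub>1 A B \<cdot> h = \<pi>\<^sub>1 A B \<cdot> k" "\<pi>\<^sub>2 A B \<cdot> h = \<pi>\<^sub>2 A B \<cdot> k"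
  shows "h = k"
proof -
  have "h = \<langle>\<pi>\<^sub>1 A B \<cdot> h, \<pi>\<^sub>2 A B \<cdot> h\<rangle>"
    by (rule Tuple_unique[of A B h "Dom C h", symmetric]) (use assms in \<open>simp_all add: hom_def\<close>)
  also have "\<dots> = \<langle>\<pi>\<^sub>1 A B \<cdot> k, \<pi>\<^sub>2 A B \<cdot> k\<rangle>"
    using assms(7,8) by simp
  also have "\<dots> = k"
    by (rule Tuple_unique[of A B k "Dom C k"]) (use assms in \<open>simp_all add: hom_def\<close>)
  finally show ?thesis .
qed

lemma Tuple_Comp [simp]:
  assumes "f \<in> Arr C" "g \<in> Arr C" "Dom C f = Dom C g" "x \<in> Arr C" "Cod C x = Dom C g"
  shows "\<langle>f, g\<rangle> \<cdot> x = \<langle>f \<cdot> x, g \<cdot> x\<rangle>"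
proof (rule Tuple_eqI[of _ _ "Cod C f" "Cod C g"])
  have "\<pi>\<^sub>1 (Cod C f) (Cod C g) \<cdot> \<langle>f, g\<rangle> \<cdot> x = (\<pi>\<^sub>1 (Cod C f) (Cod C g) \<cdot> \<langle>f, g\<rangle>) \<cdot> x"
    using assms by (subst Comp_assoc_arr) auto
  then show "\<pi>\<^sub>1 (Cod C f) (Cod C g) \<cdot> \<langle>f, g\<rangle> \<cdot> x = \<pi>\<^sub>1 (Cod C f) (Cod C g) \<cdot> \<langle>f \<cdot> x, g \<cdot> x\<rangle>"
    using assms by simp
  have "\<pi>\<^sub>2 (Cod C f) (Cod C g) \<cdot> \<langle>f, g\<rangle> \<cdot> x = (\<pi>\<^sub>2 (Cod C f) (Cod C g) \<cdot> \<langle>f, g\<rangle>) \<cdot> x"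
    using assms by (subst Comp_assoc_arr) auto
  then show "\<pi>\<^sub>2 (Cod C f) (Cod C g) \<cdot> \<langle>f, g\<rangle> \<cdot> x = \<pi>\<^sub>2 (Cod C f) (Cod C g) \<cdot> \<langle>f \<cdot> x, g \<cdot> x\<rangle>"
    using assms by simp
qed (use assms in auto)

lemma Tuple_Proj [simp]:
  assumes "A \<in> Obj C" "B \<in> Obj C"
  shows "\<langle>\<pi>\<^sub>1 A B, \<pi>\<^sub>2 A B\<rangle> = \<one> (A \<otimes> B)"
  using Tuple_unique[of A B "\<one> (A \<otimes> B)" "A \<otimes> B"] assms by (simp add: Idt_hom)

lemma Tuple_Proj_Comp [simp]:
  assumes "A \<in> Obj C" "B \<in> Obj C" "h \<in> Arr C" "Cod C h = A \<otimes> B"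
  shows "\<langle>\<pi>\<^sub>1 A B \<cdot> h, \<pi>\<^sub>2 A B \<cdot> h\<rangle> = h"
  using Tuple_unique[of A B h "Dom C h"] assms by (simp add: hom_def)

end

context cartesian_differential_category
begin

lemma zero_arr [simp]:
  assumes "A \<in> Obj K" "B \<in> Obj K"
  shows "zero A B \<in> Arr K" "Dom K (zero A B) = A" "Cod K (zero A B) = B"
  using zero_hom[OF assms] by (auto simp: hom_def)

lemma add_arr [simp]:
  assumes "f \<in> Arr K" "g \<in> Arr K" "Dom K f = Dom K g" "Cod K f = Cod K g"
  shows "add f g \<in> Arr K" "Dom K (add f g) = Dom K g" "Cod K (add f g) = Cod K g"
  using add_hom[of f "Dom K g" "Cod K g" g] assms by (auto simp: hom_def)

lemma D_arr [simp]:
  assumes "f \<in> Arr K"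
  shows "D f \<in> Arr K" "Dom K (D f) = Dom K f \<otimes> Dom K f" "Cod K (D f) = Cod K f"
  using D_hom[of f "Dom K f" "Cod K f"] assms by (auto simp: hom_def)

lemma zero_Comp_arr [simp]:
  "x \<in> Arr K \<Longrightarrow> Cod K x = A \<Longrightarrow> B \<in> Obj K \<Longrightarrow> zero A B \<cdot> x = zero (Dom K x) B"
  using zero_Comp[of x "Dom K x" A B] by (auto simp: hom_def)

lemma add_Comp_arr [simp]:
  assumes "f \<in> Arr K" "g \<in> Arr K" "Dom K f = Dom K g" "Cod K f = Cod K g" "x \<in> Arr K" "Cod K x = Dom K g"
  shows "add f g \<cdot> x = add (f \<cdot> x) (g \<cdot> x)"
  using add_Comp[of x "Dom K x" "Dom K g" f "Cod K g" g] assms by (auto simp: hom_def)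

lemma add_zero_arr [simp]:
  assumes "f \<in> Arr K" "Dom K f = A" "Cod K f = B"
  shows "add f (zero A B) = f" "add (zero A B) f = f"
proof -
  have A: "A \<in> Obj K" "B \<in> Obj K" using assms by auto
  show "add f (zero A B) = f" using add_zero[of f A B] assms by (auto simp: hom_def)
  then show "add (zero A B) f = f"
    using add_commute[of f A B "zero A B"] assms A by (auto simp: hom_def)
qed

lemma Proj_zero [simp]:
  assumes "A \<in> Obj K" "B \<in> Obj K" "X \<in> Obj K"
  shows "\<pi>\<^sub>1 A B \<cdot> zero X (A \<otimes> B) = zero X A" "\<pi>\<^sub>2 A B \<cdot> zero X (A \<otimes> B) = zero X B"
  using Proj1_additive[OF assms(1,2)] Proj2_additive[OF assms(1,2)] assms
  by (auto simp: additive_map_def)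

lemma zero_Prod:
  assumes "A \<in> Obj K" "B \<in> Obj K" "X \<in> Obj K"
  shows "zero X (A \<otimes> B) = \<langle>zero X A, zero X B\<rangle>"
  using Tuple_unique[of A B "zero X (A \<otimes> B)" X] assms by (simp add: hom_def)

lemma D_zero_vector:
  assumes "f \<in> Arr K" "x \<in> Arr K" "Cod K x = Dom K f" "Dom K x = X"
  shows "D f \<cdot> \<langle>x, zero X (Dom K f)\<rangle> = zero X (Cod K f)"
  using CD2_zero[of f "Dom K f" "Cod K f" x X] assms by (auto simp: hom_def)

lemma D_Comp:
  assumes "f \<in> Arr K" "g \<in> Arr K" "Dom K g = Cod K f" "x \<in> Arr K" "y \<in> Arr K"
    "Dom K x = Dom K y" "Cod K x = Dom K f" "Cod K y = Dom K f"
  shows "D (g \<cdot> f) \<cdot> \<langle>x, y\<rangle> = D g \<cdot> \<langle>f \<cdot> x, D f \<cdot> \<langle>x, y\<rangle>\<rangle>"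
  using CD5[of f "Dom K f" "Cod K f" g "Cod K g"] assms by (simp add: hom_def)

lemma D_Tuple [simp]:
  assumes "f \<in> Arr K" "g \<in> Arr K" "Dom K f = Dom K g"
  shows "D \<langle>f, g\<rangle> = \<langle>D f, D g\<rangle>"
  using CD4[of f "Dom K g" "Cod K f" g "Cod K g"] assms by (simp add: hom_def)

lemma D_zero [simp]: "A \<in> Obj K \<Longrightarrow> B \<in> Obj K \<Longrightarrow> D (zero A B) = zero (A \<otimes> A) B"
  by (rule CD1_zero)

lemma D_add [simp]:
  assumes "f \<in> Arr K" "g \<in> Arr K" "Dom K f = Dom K g" "Cod K f = Cod K g"
  shows "D (add f g) = add (D f) (D g)"
  using CD1_add[of f "Dom K g" "Cod K g" g] assms by (simp add: hom_def)

lemma D_Proj [simp]: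
  assumes "A \<in> Obj K" "B \<in> Obj K"
  shows "D (\<pi>\<^sub>1 A B) = \<pi>\<^sub>1 A B \<cdot> \<pi>\<^sub>2 (A \<otimes> B) (A \<otimes> B)" "D (\<pi>\<^sub>2 A B) = \<pi>\<^sub>2 A B \<cdot> \<pi>\<^sub>2 (A \<otimes> B) (A \<otimes> B)"
  using CD3_Proj1 CD3_Proj2 assms by auto

lemma D_Idt [simp]: "A \<in> Obj K \<Longrightarrow> D (\<one> A) = \<pi>\<^sub>2 A A"
  by (rule CD3_Idt)

lemma D_D_vertical:
  assumes "f \<in> Arr K" "x \<in> Arr K" "y \<in> Arr K" "z \<in> Arr K"
    "Dom K x = X" "Dom K y = X" "Dom K z = X" "Cod K x = Dom K f" "Cod K y = Dom K f" "Cod K z = Dom K f"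
    and "e = zero X (Dom K f)"
  shows "D (D f) \<cdot> \<langle>\<langle>x, y\<rangle>, \<langle>e, z\<rangle>\<rangle> = D f \<cdot> \<langle>x, z\<rangle>"
  using CD6[of f "Dom K f" "Cod K f" x X y z] assms by (simp add: hom_def)

lemma linear_D:
  assumes "linear_map K D s" "k \<in> Arr K" "Dom K s = Cod K k"
  shows "D (s \<cdot> k) = s \<cdot> D k"
  using CD5[of k "Dom K k" "Cod K k" s "Cod K s"] assms
  by (simp add: linear_map_def hom_def)

lemma linear_zero:
  assumes "linear_map K D s" "X \<in> Obj K" "Dom K s = A"
  shows "s \<cdot> zero X A = zero X (Cod K s)"
  using CD2_zero[of s A "Cod K s" "zero X A" X] assms
  by (auto simp: linear_map_def hom_def)

lemma linear_add:
  assumes "linear_map K D s" "y \<in> Arr K" "z \<in> Arr K" "Dom K y = Dom K z"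
    "Cod K y = Dom K s" "Cod K z = Dom K s"
  shows "s \<cdot> add y z = add (s \<cdot> y) (s \<cdot> z)"
  using CD2_add[of s "Dom K s" "Cod K s" y "Dom K z" y z] assms
  by (auto simp: linear_map_def hom_def)

end

section \<open>Equations with a unique solution\<close>

text \<open>
  The co-Kleisli category of a comonad with bifree algebras, described without the base category.
  \<open>S\<close> consists of the maps \<open>J(g)\<close>. The identity of \<open>F A\<close> in the base is a map \<open>\<eta> : A \<rightarrow> F A\<close> here,
  and \<open>lift k\<close> is the map \<open>k : F A \<rightarrow> B\<close> of the base, pushed forward by \<open>J\<close>. In
  \<open>unfold_unique\<close> a map \<open>z : E \<rightarrow> F (A \<times> F E)\<close> is the same thing as a coalgebra of \<open>F (A \<times> -)\<close> on
  the object \<open>F E\<close>, and a coalgebra morphism from it to \<open>\<Phi> A\<close> is a map \<open>E \<rightarrow> \<Phi> A\<close>; composing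
  with \<open>w\<close> replaces the inverse of \<open>w\<close> in the usual square.
\<close>

locale differential_coKleisli = cartesian_differential_category K zero add D
  for K :: "('o, 'm, 'z) cartesian_data_scheme" (structure)
    and zero :: "'o \<Rightarrow> 'o \<Rightarrow> 'm" and add :: "'m \<Rightarrow> 'm \<Rightarrow> 'm" and D :: "'m \<Rightarrow> 'm" +
  fixes S :: "'m set" and F :: "'o \<Rightarrow> 'o" and \<eta> :: "'o \<Rightarrow> 'm" and lift :: "'m \<Rightarrow> 'm"
    and \<Phi> :: "'o \<Rightarrow> 'o" and w :: "'o \<Rightarrow> 'm"
  assumes S_linear: "s \<in> S \<Longrightarrow> linear_map K D s"
    and S_Comp: "r \<in> S \<Longrightarrow> s \<in> S \<Longrightarrow> Dom K r = Cod K s \<Longrightarrow> r \<cdot> s \<in> S"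
    and S_Tuple: "r \<in> S \<Longrightarrow> s \<in> S \<Longrightarrow> Dom K r = Dom K s \<Longrightarrow> \<langle>r, s\<rangle> \<in> S"
    and S_Proj1: "A \<in> Obj K \<Longrightarrow> B \<in> Obj K \<Longrightarrow> \<pi>\<^sub>1 A B \<in> S"
    and S_Proj2: "A \<in> Obj K \<Longrightarrow> B \<in> Obj K \<Longrightarrow> \<pi>\<^sub>2 A B \<in> S"
    and F_Obj [simp]: "A \<in> Obj K \<Longrightarrow> F A \<in> Obj K"
    and \<eta>_hom: "A \<in> Obj K \<Longrightarrow> \<eta> A \<in> hom K A (F A)"
    and lift_S: "k \<in> hom K A B \<Longrightarrow> lift k \<in> S"
    and lift_hom: "k \<in> hom K A B \<Longrightarrow> lift k \<in> hom K (F A) B"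
    and lift_\<eta>: "k \<in> hom K A B \<Longrightarrow> lift k \<cdot> \<eta> A = k"
    and \<Phi>_Obj [simp]: "A \<in> Obj K \<Longrightarrow> \<Phi> A \<in> Obj K"
    and w_hom: "A \<in> Obj K \<Longrightarrow> w A \<in> hom K (A \<otimes> \<Phi> A) (\<Phi> A)"
    and fold_exists: "A \<in> Obj K \<Longrightarrow> X \<in> Obj K \<Longrightarrow> f \<in> hom K (A \<otimes> X) X \<Longrightarrow>
      \<exists>u\<in>S. u \<in> hom K (\<Phi> A) X \<and> u \<cdot> w A = f \<cdot> \<langle>\<pi>\<^sub>1 A (\<Phi> A), u \<cdot> \<pi>\<^sub>2 A (\<Phi> A)\<rangle>"
    and unfold_unique: "A \<in> Obj K \<Longrightarrow> E \<in> Obj K \<Longrightarrow> z \<in> hom K E (F (A \<otimes> F E)) \<Longrightarrow>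
      \<exists>!x. x \<in> hom K E (\<Phi> A) \<and>
        lift (w A \<cdot> \<langle>\<pi>\<^sub>1 A (F E), lift x \<cdot> \<pi>\<^sub>2 A (F E)\<rangle>) \<cdot> z = x"
begin

lemma S_arr: "s \<in> S \<Longrightarrow> s \<in> Arr K"
  using S_linear by (auto simp: linear_map_def)

lemma S_zero: "s \<in> S \<Longrightarrow> X \<in> Obj K \<Longrightarrow> Dom K s = A \<Longrightarrow> s \<cdot> zero X A = zero X (Cod K s)"
  using S_linear linear_zero by blast

lemma S_D: "s \<in> S \<Longrightarrow> D s = s \<cdot> \<pi>\<^sub>2 (Dom K s) (Dom K s)"
  using S_linear by (auto simp: linear_map_def)

lemmas S_simps = S_arr S_D S_zero

lemma \<eta>_arr [simp]:
  assumes "A \<in> Obj K"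
  shows "\<eta> A \<in> Arr K" "Dom K (\<eta> A) = A" "Cod K (\<eta> A) = F A"
  using \<eta>_hom[OF assms] by (auto simp: hom_iff)

lemma w_arr [simp]:
  assumes "A \<in> Obj K"
  shows "w A \<in> Arr K" "Dom K (w A) = A \<otimes> \<Phi> A" "Cod K (w A) = \<Phi> A"
  using w_hom[OF assms] by (auto simp: hom_iff)

lemma lift_arr [simp]:
  assumes "k \<in> Arr K"
  shows "lift k \<in> S" "lift k \<in> Arr K" "Dom K (lift k) = F (Dom K k)" "Cod K (lift k) = Cod K k"
    "D (lift k) = lift k \<cdot> \<pi>\<^sub>2 (F (Dom K k)) (F (Dom K k))"
  using lift_S[of k "Dom K k" "Cod K k"] lift_hom[of k "Dom K k" "Cod K k"] assms
    S_D[of "lift k"]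
  by (auto simp: hom_iff)

lemma lift_zero [simp]:
  assumes "k \<in> Arr K" "X \<in> Obj K" "A = F (Dom K k)"
  shows "lift k \<cdot> zero X A = zero X (Cod K k)"
  using assms S_zero[of "lift k" X A] by simp

lemma lift_\<eta>_arr [simp]: "k \<in> Arr K \<Longrightarrow> Dom K k = A \<Longrightarrow> lift k \<cdot> \<eta> A = k"
  using lift_\<eta>[of k A "Cod K k"] by (auto simp: hom_iff)

lemma lift_\<eta>_Comp [simp]:
  assumes "k \<in> Arr K" "Dom K k = A" "x \<in> Arr K" "Cod K x = A"
  shows "lift k \<cdot> \<eta> A \<cdot> x = k \<cdot> x"
proof -
  have "A \<in> Obj K" using assms by auto
  then have "lift k \<cdot> \<eta> A \<cdot> x = (lift k \<cdot> \<eta> A) \<cdot> x"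
    using assms by (subst Comp_assoc_arr) auto
  then show ?thesis using assms by simp
qed

text \<open>
  Linearity of \<open>lift k\<close> lets a coalgebra made from \<open>D (\<eta> A)\<close> produce derivatives of the
  unknown map, whatever that map is.
\<close>

lemma lift_D_\<eta> [simp]:
  assumes "k \<in> Arr K" "Dom K k = A" "x \<in> Arr K" "Cod K x = A \<otimes> A"
  shows "lift k \<cdot> D (\<eta> A) \<cdot> x = D k \<cdot> x"
proof -
  have A: "A \<in> Obj K" using assms by auto
  then have "lift k \<cdot> D (\<eta> A) \<cdot> x = (lift k \<cdot> D (\<eta> A)) \<cdot> x"
    using assms by (subst Comp_assoc_arr) auto
  also have "lift k \<cdot> D (\<eta> A) = D (lift k \<cdot> \<eta> A)"
    using linear_D[OF S_linear, of "lift k" "\<eta> A"] assms A by simp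
  finally show ?thesis using assms by simp
qed

lemma S_add:
  assumes "s \<in> S" "y \<in> Arr K" "z \<in> Arr K" "Dom K y = Dom K z" "Cod K y = Dom K s" "Cod K z = Dom K s"
  shows "s \<cdot> add y z = add (s \<cdot> y) (s \<cdot> z)"
  using linear_add S_linear assms by blast

text \<open>The coalgebra \<open>e \<mapsto> \<eta>(g e, \<eta> e)\<close> has the solutions of \<open>x = w(g, x)\<close> as its morphisms to \<open>\<Phi> A\<close>.\<close>

lemma w_solution_unique:
  assumes "g \<in> Arr K" "Dom K g = E" "Cod K g = A"
  shows "\<exists>!x. x \<in> hom K E (\<Phi> A) \<and> w A \<cdot> \<langle>g, x\<rangle> = x"
proof -
  have O: "A \<in> Obj K" "E \<in> Obj K" using assms by auto
  let ?z = "\<eta> (A \<otimes> F E) \<cdot> \<langle>g, \<eta> E\<rangle>"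
  have "lift (w A \<cdot> \<langle>\<pi>\<^sub>1 A (F E), lift x \<cdot> \<pi>\<^sub>2 A (F E)\<rangle>) \<cdot> ?z = w A \<cdot> \<langle>g, x\<rangle>"
    if "x \<in> hom K E (\<Phi> A)" for x
    using that assms O by (simp add: hom_iff)
  then show ?thesis
    using unfold_unique[of A E ?z] assms O by (simp add: hom_iff cong: conj_cong)
qed

text \<open>
  The coalgebra is \<open>e \<mapsto> D[\<eta>]((a e, 0), (b e, \<eta> e))\<close>. Its second base coordinate lies in \<open>F E\<close> and is sent
  to the base point of the equation by the lift of the unknown \<open>x\<close>. Only \<open>0\<close> has an image
  that does not depend on \<open>x\<close>, which is why the derivative is taken at \<open>0\<close>.
\<close>

lemma w_derivative_solution_unique:
  assumes "a \<in> Arr K" "b \<in> Arr K" "Dom K a = E" "Dom K b = E" "Cod K a = A" "Cod K b = A"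
  shows "\<exists>!x. x \<in> hom K E (\<Phi> A) \<and> D (w A) \<cdot> \<langle>\<langle>a, zero E (\<Phi> A)\<rangle>, \<langle>b, x\<rangle>\<rangle> = x"
proof -
  have O: "A \<in> Obj K" "E \<in> Obj K" using assms by auto
  let ?z = "D (\<eta> (A \<otimes> F E)) \<cdot> \<langle>\<langle>a, zero E (F E)\<rangle>, \<langle>b, \<eta> E\<rangle>\<rangle>"
  have "lift (w A \<cdot> \<langle>\<pi>\<^sub>1 A (F E), lift x \<cdot> \<pi>\<^sub>2 A (F E)\<rangle>) \<cdot> ?z
      = D (w A) \<cdot> \<langle>\<langle>a, zero E (\<Phi> A)\<rangle>, \<langle>b, x\<rangle>\<rangle>"
    if "x \<in> hom K E (\<Phi> A)" for x
    using that assms O by (simp add: hom_iff D_Comp)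
  then show ?thesis
    using unfold_unique[of A E ?z] assms O by (simp add: hom_iff cong: conj_cong)
qed

text \<open>
  In elements: \<open>h(a, b) = w(a, h(a, 0)) + D[w]((a, h(a, 0)), (b, h'(a, b)))\<close>, with \<open>h'(a, b)\<close> the
  derivative of \<open>h\<close> at \<open>(a, 0)\<close> in direction \<open>(0, b)\<close>. Now \<open>h\<close> itself carries the base point
  \<open>h(a, 0)\<close>, so it need not be \<open>0\<close>: the coalgebra refers to it by \<open>\<eta>(a, 0)\<close> and to \<open>h'(a, b)\<close> by
  \<open>D[\<eta>]((a, 0), (0, b))\<close>.
\<close>

lemma w_first_order_solution_unique:
  fixes A
  defines "b \<equiv> \<langle>\<pi>\<^sub>1 A A, zero (A \<otimes> A) A\<rangle>" and "v \<equiv> \<langle>zero (A \<otimes> A) A, \<pi>\<^sub>2 A A\<rangle>"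
  assumes A: "A \<in> Obj K"
  shows "\<exists>!h. h \<in> hom K (A \<otimes> A) (\<Phi> A) \<and>
    add (w A \<cdot> \<langle>\<pi>\<^sub>1 A A, h \<cdot> b\<rangle>)
      (D (w A) \<cdot> \<langle>\<langle>\<pi>\<^sub>1 A A, h \<cdot> b\<rangle>, \<langle>\<pi>\<^sub>2 A A, D h \<cdot> \<langle>b, v\<rangle>\<rangle>\<rangle>) = h"
proof -
  let ?E = "A \<otimes> A"
  have bv: "b \<in> Arr K" "Dom K b = ?E" "Cod K b = ?E" "v \<in> Arr K" "Dom K v = ?E" "Cod K v = ?E"
    using A by (simp_all add: b_def v_def)
  let ?p = "\<langle>\<pi>\<^sub>1 A A, \<eta> ?E \<cdot> b\<rangle>"
  let ?z = "add (\<eta> (A \<otimes> F ?E) \<cdot> ?p) (D (\<eta> (A \<otimes> F ?E)) \<cdot> \<langle>?p, \<langle>\<pi>\<^sub>2 A A, D (\<eta> ?E) \<cdot> \<langle>b, v\<rangle>\<rangle>\<rangle>)"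
  have "lift (w A \<cdot> \<langle>\<pi>\<^sub>1 A (F ?E), lift h \<cdot> \<pi>\<^sub>2 A (F ?E)\<rangle>) \<cdot> ?z
      = add (w A \<cdot> \<langle>\<pi>\<^sub>1 A A, h \<cdot> b\<rangle>)
      (D (w A) \<cdot> \<langle>\<langle>\<pi>\<^sub>1 A A, h \<cdot> b\<rangle>, \<langle>\<pi>\<^sub>2 A A, D h \<cdot> \<langle>b, v\<rangle>\<rangle>\<rangle>)"
    if "h \<in> hom K (A \<otimes> A) (\<Phi> A)" for h
    using that A bv by (simp add: hom_iff D_Comp S_add)
  then show ?thesis
    using unfold_unique[of A ?E ?z] A bv by (simp add: hom_iff cong: conj_cong)
qed

definition point :: "'o \<Rightarrow> 'm" where
  "point A = (THE t. t \<in> hom K A (\<Phi> A) \<and> w A \<cdot> \<langle>\<one> A, t\<rangle> = t)"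

lemma point_arr [simp]:
  assumes "A \<in> Obj K"
  shows "point A \<in> Arr K" "Dom K (point A) = A" "Cod K (point A) = \<Phi> A"
    and w_point: "w A \<cdot> \<langle>\<one> A, point A\<rangle> = point A"
proof -
  have "point A \<in> hom K A (\<Phi> A) \<and> w A \<cdot> \<langle>\<one> A, point A\<rangle> = point A"
    unfolding point_def by (rule theI') (use assms w_solution_unique[of "\<one> A" A A] in simp)
  then show "point A \<in> Arr K" "Dom K (point A) = A" "Cod K (point A) = \<Phi> A" "w A \<cdot> \<langle>\<one> A, point A\<rangle> = point A"
    by (auto simp: hom_iff)
qed

lemma w_point_Comp:
  assumes "g \<in> Arr K" "Cod K g = A"
  shows "w A \<cdot> \<langle>g, point A \<cdot> g\<rangle> = point A \<cdot> g"
proof -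
  have A: "A \<in> Obj K" using assms by auto
  then have "w A \<cdot> \<langle>g, point A \<cdot> g\<rangle> = (w A \<cdot> \<langle>\<one> A, point A\<rangle>) \<cdot> g"
    using assms by (simp del: w_point)
  then show ?thesis by (simp only: w_point[OF A])
qed

lemma point_unique:
  assumes "g \<in> Arr K" "Cod K g = A" "x \<in> Arr K" "Dom K x = Dom K g" "Cod K x = \<Phi> A"
    and "w A \<cdot> \<langle>g, x\<rangle> = x"
  shows "x = point A \<cdot> g"
proof -
  have "A \<in> Obj K" using assms by auto
  then have "point A \<cdot> g \<in> hom K (Dom K g) (\<Phi> A)" "x \<in> hom K (Dom K g) (\<Phi> A)"
    using assms by (simp_all add: hom_iff)
  then show ?thesis
    using w_solution_unique[of g "Dom K g" A] w_point_Comp[of g A] assms by blast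
qed

end

section \<open>Bifree fixpoints\<close>

text \<open>
  The fixpoint is characterized through an arbitrary fold, so uniformity along \<open>S\<close> follows by composing
  folds with maps of \<open>S\<close>.
\<close>

locale bifree_fixpoint = differential_coKleisli K zero add D S F \<eta> lift \<Phi> w
  for K :: "('o, 'm, 'z) cartesian_data_scheme" (structure)
    and zero :: "'o \<Rightarrow> 'o \<Rightarrow> 'm" and add :: "'m \<Rightarrow> 'm \<Rightarrow> 'm" and D :: "'m \<Rightarrow> 'm"
    and S :: "'m set" and F :: "'o \<Rightarrow> 'o" and \<eta> :: "'o \<Rightarrow> 'm" and lift :: "'m \<Rightarrow> 'm"
    and \<Phi> :: "'o \<Rightarrow> 'o" and w :: "'o \<Rightarrow> 'm" +
  fixes fixp :: "'o \<Rightarrow> 'o \<Rightarrow> 'm \<Rightarrow> 'm"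
  assumes fixp_fold: "A \<in> Obj K \<Longrightarrow> X \<in> Obj K \<Longrightarrow> f \<in> hom K (A \<otimes> X) X \<Longrightarrow>
      u \<in> S \<Longrightarrow> Dom K u = \<Phi> A \<Longrightarrow> Cod K u = X \<Longrightarrow>
      u \<cdot> w A = f \<cdot> \<langle>\<pi>\<^sub>1 A (\<Phi> A), u \<cdot> \<pi>\<^sub>2 A (\<Phi> A)\<rangle> \<Longrightarrow> fixp A X f = u \<cdot> point A"
begin

lemma fold_ex:
  assumes "f \<in> Arr K" "Dom K f = A \<otimes> X" "Cod K f = X" "A \<in> Obj K" "X \<in> Obj K"
  shows "\<exists>u. u \<in> S \<and> Dom K u = \<Phi> A \<and> Cod K u = X \<and>
    u \<cdot> w A = f \<cdot> \<langle>\<pi>\<^sub>1 A (\<Phi> A), u \<cdot> \<pi>\<^sub>2 A (\<Phi> A)\<rangle> \<and> fixp A X f = u \<cdot> point A"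
proof -
  have f: "f \<in> hom K (A \<otimes> X) X" using assms by (simp add: hom_iff)
  obtain u where u: "u \<in> S" "u \<in> hom K (\<Phi> A) X"
    "u \<cdot> w A = f \<cdot> \<langle>\<pi>\<^sub>1 A (\<Phi> A), u \<cdot> \<pi>\<^sub>2 A (\<Phi> A)\<rangle>"
    using fold_exists[OF assms(4,5) f] by blast
  then have "Dom K u = \<Phi> A" "Cod K u = X" by (simp_all add: hom_iff)
  then show ?thesis using u fixp_fold[OF assms(4,5) f] by blast
qed


lemma fixp_arr [simp]:
  assumes "f \<in> Arr K" "Dom K f = A \<otimes> X" "Cod K f = X" "A \<in> Obj K" "X \<in> Obj K"
  shows "fixp A X f \<in> Arr K" "Dom K (fixp A X f) = A" "Cod K (fixp A X f) = X"
  using fold_ex[OF assms] assms by (auto simp: S_arr)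

lemma fixp_unfold:
  assumes "f \<in> Arr K" "Dom K f = A \<otimes> X" "Cod K f = X" "A \<in> Obj K" "X \<in> Obj K"
  shows "f \<cdot> \<langle>\<one> A, fixp A X f\<rangle> = fixp A X f"
proof -
  obtain u where u: "u \<in> S" "Dom K u = \<Phi> A" "Cod K u = X"
    "u \<cdot> w A = f \<cdot> \<langle>\<pi>\<^sub>1 A (\<Phi> A), u \<cdot> \<pi>\<^sub>2 A (\<Phi> A)\<rangle>" "fixp A X f = u \<cdot> point A"
    using fold_ex[OF assms] by blast
  note us = u(1-3) S_simps[OF u(1)]
  have "f \<cdot> \<langle>\<one> A, u \<cdot> point A\<rangle> = (u \<cdot> w A) \<cdot> \<langle>\<one> A, point A\<rangle>"
    unfolding u(4) using assms us by simp
  then show ?thesis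
    using us assms by (simp add: u(5))
qed

lemma fixp_uniform:
  assumes "h \<in> S" "Dom K h = X" "Cod K h = Y"
    and "f \<in> Arr K" "Dom K f = A \<otimes> X" "Cod K f = X"
    and "g \<in> Arr K" "Dom K g = A \<otimes> Y" "Cod K g = Y" "A \<in> Obj K"
    and "h \<cdot> f = g \<cdot> \<langle>\<pi>\<^sub>1 A X, h \<cdot> \<pi>\<^sub>2 A X\<rangle>"
  shows "h \<cdot> fixp A X f = fixp A Y g"
proof -
  note h = S_simps[OF assms(1)]
  have XY: "X \<in> Obj K" "Y \<in> Obj K" using assms h by auto
  obtain u where u: "u \<in> S" "Dom K u = \<Phi> A" "Cod K u = X"
    "u \<cdot> w A = f \<cdot> \<langle>\<pi>\<^sub>1 A (\<Phi> A), u \<cdot> \<pi>\<^sub>2 A (\<Phi> A)\<rangle>" "fixp A X f = u \<cdot> point A"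
    using fold_ex[of f A X] assms XY by blast
  note us = u(1-3) S_simps[OF u(1)]
  have "(h \<cdot> u) \<cdot> w A = (h \<cdot> f) \<cdot> \<langle>\<pi>\<^sub>1 A (\<Phi> A), u \<cdot> \<pi>\<^sub>2 A (\<Phi> A)\<rangle>"
    using h assms(1-10) XY us u(4) by simp
  also have "\<dots> = g \<cdot> \<langle>\<pi>\<^sub>1 A (\<Phi> A), (h \<cdot> u) \<cdot> \<pi>\<^sub>2 A (\<Phi> A)\<rangle>"
    unfolding assms(11) using h assms(1-10) XY us by simp
  finally have "fixp A Y g = (h \<cdot> u) \<cdot> point A"
    using h assms(1-10) XY us S_Comp[of h u] by (intro fixp_fold) (auto simp: hom_iff)
  then show ?thesis using h assms(1-10) XY us by (simp add: u(5))
qed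

text \<open>
  Reindexing along \<open>g\<close> is uniformity along the fold of \<open>f\<close>, applied to the map \<open>(a, x) \<mapsto> w(g a, x)\<close>,
  whose fixpoint must be \<open>t \<circ> g\<close>.
\<close>

lemma fixp_natural:
  assumes "g \<in> Arr K" "Dom K g = A" "Cod K g = B" "X \<in> Obj K"
    and "f \<in> Arr K" "Dom K f = B \<otimes> X" "Cod K f = X"
  shows "fixp B X f \<cdot> g = fixp A X (f \<cdot> \<langle>g \<cdot> \<pi>\<^sub>1 A X, \<pi>\<^sub>2 A X\<rangle>)"
proof -
  have AB: "A \<in> Obj K" "B \<in> Obj K" using assms by auto
  let ?k = "w B \<cdot> \<langle>g \<cdot> \<pi>\<^sub>1 A (\<Phi> B), \<pi>\<^sub>2 A (\<Phi> B)\<rangle>"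
  obtain u where u: "u \<in> S" "Dom K u = \<Phi> B" "Cod K u = X"
    "u \<cdot> w B = f \<cdot> \<langle>\<pi>\<^sub>1 B (\<Phi> B), u \<cdot> \<pi>\<^sub>2 B (\<Phi> B)\<rangle>" "fixp B X f = u \<cdot> point B"
    using fold_ex[of f B X] assms AB by blast
  note us = u(1-3) S_simps[OF u(1)]
  have "?k \<cdot> \<langle>\<one> A, fixp A (\<Phi> B) ?k\<rangle> = fixp A (\<Phi> B) ?k"
    using assms AB by (intro fixp_unfold) simp_all
  then have k: "fixp A (\<Phi> B) ?k = point B \<cdot> g"
    using assms AB by (intro point_unique) simp_all
  have "u \<cdot> ?k = (u \<cdot> w B) \<cdot> \<langle>g \<cdot> \<pi>\<^sub>1 A (\<Phi> B), \<pi>\<^sub>2 A (\<Phi> B)\<rangle>"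
    using assms AB us by simp
  also have "\<dots> = (f \<cdot> \<langle>g \<cdot> \<pi>\<^sub>1 A X, \<pi>\<^sub>2 A X\<rangle>) \<cdot> \<langle>\<pi>\<^sub>1 A (\<Phi> B), u \<cdot> \<pi>\<^sub>2 A (\<Phi> B)\<rangle>"
    unfolding u(4) using assms AB us by simp
  finally have "u \<cdot> fixp A (\<Phi> B) ?k = fixp A X (f \<cdot> \<langle>g \<cdot> \<pi>\<^sub>1 A X, \<pi>\<^sub>2 A X\<rangle>)"
    using assms AB us by (intro fixp_uniform) simp_all
  then show ?thesis using assms AB us by (simp add: k u(5))
qed

text \<open>
  The Bekic identity for a system whose first equation does not mention the second unknown. Let \<open>u\<close> be
  the fold of \<open>g\<close>. Folding \<open>f\<close> together with the bifree map over \<open>P \<times> X\<close> gives \<open>(r1, r2)\<close>, and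
  \<open>(r1, u \<circ> r2)\<close> is a fold of the whole system. The map \<open>r2\<close> sends \<open>t\<close> for \<open>P\<close> to \<open>t\<close> for
  \<open>P \<times> X\<close>, reindexed along \<open>(1, fixp f)\<close>, because equations \<open>x = w(g, x)\<close> have one solution.
\<close>

lemma fixp_triangular:
  assumes "P \<in> Obj K" "X \<in> Obj K" "Y \<in> Obj K"
    and f: "f \<in> Arr K" "Dom K f = P \<otimes> X" "Cod K f = X"
    and g: "g \<in> Arr K" "Dom K g = (P \<otimes> X) \<otimes> Y" "Cod K g = Y"
  shows "fixp P (X \<otimes> Y)
      \<langle>f \<cdot> \<langle>\<pi>\<^sub>1 P (X \<otimes> Y), \<pi>\<^sub>1 X Y \<cdot> \<pi>\<^sub>2 P (X \<otimes> Y)\<rangle>,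
       g \<cdot> \<langle>\<langle>\<pi>\<^sub>1 P (X \<otimes> Y), \<pi>\<^sub>1 X Y \<cdot> \<pi>\<^sub>2 P (X \<otimes> Y)\<rangle>, \<pi>\<^sub>2 X Y \<cdot> \<pi>\<^sub>2 P (X \<otimes> Y)\<rangle>\<rangle>
    = \<langle>fixp P X f, fixp (P \<otimes> X) Y g \<cdot> \<langle>\<one> P, fixp P X f\<rangle>\<rangle>"
proof -
  let ?Q = "P \<otimes> X"
  let ?Z = "X \<otimes> \<Phi> ?Q"
  note obs [simp] = assms(1-3)
  obtain u where u: "u \<in> S" "Dom K u = \<Phi> ?Q" "Cod K u = Y"
    "u \<cdot> w ?Q = g \<cdot> \<langle>\<pi>\<^sub>1 ?Q (\<Phi> ?Q), u \<cdot> \<pi>\<^sub>2 ?Q (\<Phi> ?Q)\<rangle>" "fixp ?Q Y g = u \<cdot> point ?Q"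
    using fold_ex[of g ?Q Y] g Prod_Obj obs by blast
  note us = u(1-3) S_simps[OF u(1)]
  let ?h = "\<langle>f \<cdot> \<langle>\<pi>\<^sub>1 P ?Z, \<pi>\<^sub>1 X (\<Phi> ?Q) \<cdot> \<pi>\<^sub>2 P ?Z\<rangle>,
    w ?Q \<cdot> \<langle>\<langle>\<pi>\<^sub>1 P ?Z, \<pi>\<^sub>1 X (\<Phi> ?Q) \<cdot> \<pi>\<^sub>2 P ?Z\<rangle>, \<pi>\<^sub>2 X (\<Phi> ?Q) \<cdot> \<pi>\<^sub>2 P ?Z\<rangle>\<rangle>"
  have h: "?h \<in> Arr K" "Dom K ?h = P \<otimes> ?Z" "Cod K ?h = ?Z" "P \<in> Obj K" "?Z \<in> Obj K"
    using f by simp_all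
  obtain r where r: "r \<in> S" "Dom K r = \<Phi> P" "Cod K r = ?Z"
    "r \<cdot> w P = ?h \<cdot> \<langle>\<pi>\<^sub>1 P (\<Phi> P), r \<cdot> \<pi>\<^sub>2 P (\<Phi> P)\<rangle>"
    using fold_ex[OF h] by blast
  note rs = r(1-3) S_simps[OF r(1)]
  define r1 where "r1 = \<pi>\<^sub>1 X (\<Phi> ?Q) \<cdot> r"
  define r2 where "r2 = \<pi>\<^sub>2 X (\<Phi> ?Q) \<cdot> r"
  have rS [simp]: "r1 \<in> S" "r2 \<in> S"
    using rs by (auto simp: r1_def r2_def intro!: S_Comp S_Proj1 S_Proj2)
  have rA [simp]: "Dom K r1 = \<Phi> P" "Cod K r1 = X" "Dom K r2 = \<Phi> P" "Cod K r2 = \<Phi> ?Q"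
    using rs by (simp_all add: r1_def r2_def)
  note [simp] = S_simps[OF rS(1)] S_simps[OF rS(2)]
  have "r1 \<cdot> w P = \<pi>\<^sub>1 X (\<Phi> ?Q) \<cdot> r \<cdot> w P" "r2 \<cdot> w P = \<pi>\<^sub>2 X (\<Phi> ?Q) \<cdot> r \<cdot> w P"
    using rs by (simp_all add: r1_def r2_def)
  then have r1: "r1 \<cdot> w P = f \<cdot> \<langle>\<pi>\<^sub>1 P (\<Phi> P), r1 \<cdot> \<pi>\<^sub>2 P (\<Phi> P)\<rangle>"
    and r2: "r2 \<cdot> w P = w ?Q \<cdot> \<langle>\<langle>\<pi>\<^sub>1 P (\<Phi> P), r1 \<cdot> \<pi>\<^sub>2 P (\<Phi> P)\<rangle>, r2 \<cdot> \<pi>\<^sub>2 P (\<Phi> P)\<rangle>"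
    unfolding r(4) using rs f by (simp_all add: r1_def r2_def)
  have x: "fixp P X f = r1 \<cdot> point P"
    using f r1 by (intro fixp_fold) (simp_all add: hom_iff)
  have "(r2 \<cdot> w P) \<cdot> \<langle>\<one> P, point P\<rangle> = w ?Q \<cdot> \<langle>\<langle>\<one> P, r1 \<cdot> point P\<rangle>, r2 \<cdot> point P\<rangle>"
    unfolding r2 by simp
  then have "w ?Q \<cdot> \<langle>\<langle>\<one> P, r1 \<cdot> point P\<rangle>, r2 \<cdot> point P\<rangle> = r2 \<cdot> point P"
    by simp
  then have y: "r2 \<cdot> point P = point ?Q \<cdot> \<langle>\<one> P, r1 \<cdot> point P\<rangle>"
    by (intro point_unique) simp_all
  have "(u \<cdot> r2) \<cdot> w P = (u \<cdot> w ?Q) \<cdot> \<langle>\<langle>\<pi>\<^sub>1 P (\<Phi> P), r1 \<cdot> \<pi>\<^sub>2 P (\<Phi> P)\<rangle>, r2 \<cdot> \<pi>\<^sub>2 P (\<Phi> P)\<rangle>"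
    using us by (simp add: r2)
  also have "\<dots> = g \<cdot> \<langle>\<langle>\<pi>\<^sub>1 P (\<Phi> P), r1 \<cdot> \<pi>\<^sub>2 P (\<Phi> P)\<rangle>, (u \<cdot> r2) \<cdot> \<pi>\<^sub>2 P (\<Phi> P)\<rangle>"
    unfolding u(4) using us g by simp
  finally have *: "(u \<cdot> r2) \<cdot> w P = \<dots>" .
  have "\<langle>r1, u \<cdot> r2\<rangle> \<cdot> point P = fixp P (X \<otimes> Y)
      \<langle>f \<cdot> \<langle>\<pi>\<^sub>1 P (X \<otimes> Y), \<pi>\<^sub>1 X Y \<cdot> \<pi>\<^sub>2 P (X \<otimes> Y)\<rangle>,
       g \<cdot> \<langle>\<langle>\<pi>\<^sub>1 P (X \<otimes> Y), \<pi>\<^sub>1 X Y \<cdot> \<pi>\<^sub>2 P (X \<otimes> Y)\<rangle>, \<pi>\<^sub>2 X Y \<cdot> \<pi>\<^sub>2 P (X \<otimes> Y)\<rangle>\<rangle>"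
    using f g us r1 *
    by (intro fixp_fold[symmetric]) (simp_all add: hom_iff S_Tuple S_Comp)
  then show ?thesis
    using us by (simp add: x y u(5))
qed

section \<open>The derivative of a fixpoint\<close>

text \<open>
  The second component of the tangent fixpoint equation of \<open>k\<close>, with the unknown of the first
  component turned into a parameter: only the last coordinate is the unknown.
\<close>

definition derivative_eqn :: "'o \<Rightarrow> 'o \<Rightarrow> 'm \<Rightarrow> 'm" where
  "derivative_eqn A X k = (let P = (A \<otimes> A) \<otimes> X; p = \<pi>\<^sub>1 P X; q = \<pi>\<^sub>1 (A \<otimes> A) X \<cdot> p in
     D k \<cdot> \<langle>\<langle>\<pi>\<^sub>1 A A \<cdot> q, \<pi>\<^sub>2 (A \<otimes> A) X \<cdot> p\<rangle>, \<langle>\<pi>\<^sub>2 A A \<cdot> q, \<pi>\<^sub>2 P X\<rangle>\<rangle>)"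

lemma derivative_eqn_arr [simp]:
  assumes "k \<in> Arr K" "Dom K k = A \<otimes> X" "Cod K k = X" "A \<in> Obj K" "X \<in> Obj K"
  shows "derivative_eqn A X k \<in> Arr K" "Dom K (derivative_eqn A X k) = ((A \<otimes> A) \<otimes> X) \<otimes> X"
    "Cod K (derivative_eqn A X k) = X"
  using assms by (simp_all add: derivative_eqn_def Let_def)

lemma derivative_eqn_Comp:
  assumes "k \<in> Arr K" "Dom K k = A \<otimes> X" "Cod K k = X" "A \<in> Obj K" "X \<in> Obj K"
    and "a \<in> Arr K" "b \<in> Arr K" "x \<in> Arr K" "y \<in> Arr K"
    and "Dom K a = Z" "Dom K b = Z" "Dom K x = Z" "Dom K y = Z"
    and "Cod K a = A" "Cod K b = A" "Cod K x = X" "Cod K y = X"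
  shows "derivative_eqn A X k \<cdot> \<langle>\<langle>\<langle>a, b\<rangle>, x\<rangle>, y\<rangle> = D k \<cdot> \<langle>\<langle>a, x\<rangle>, \<langle>b, y\<rangle>\<rangle>"
  using assms by (simp add: derivative_eqn_def Let_def)

text \<open>
  The chosen fixpoint \<open>e\<close> of \<open>derivative_eqn\<close> behaves to first order in \<open>b\<close> like a map linear in
  \<open>b\<close>. Let \<open>u\<close> be the fold, so \<open>u(w(p, y)) = derivative_eqn(p, u y)\<close>. The right-hand side is linear in
  \<open>(b, u y)\<close>, hence differentiating at \<open>b = 0\<close>, \<open>y = 0\<close> shows that \<open>u\<close> also turns the linearization
  \<open>G\<close> of \<open>w\<close> into \<open>derivative_eqn\<close>. By uniformity \<open>e = u \<circ> s\<close> with \<open>s\<close> a fixpoint of \<open>G\<close>, and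
  fixpoints of \<open>G\<close> are unique. Both claims on \<open>e\<close> thus follow by checking that the two
  sides, before applying \<open>u\<close>, solve the same equation.
\<close>

lemma fixp_derivative_eqn:
  assumes k: "k \<in> Arr K" "Dom K k = A \<otimes> X" "Cod K k = X" "A \<in> Obj K" "X \<in> Obj K"
    and z: "a \<in> Arr K" "b \<in> Arr K" "x \<in> Arr K"
      "Dom K a = Z" "Dom K b = Z" "Dom K x = Z" "Cod K a = A" "Cod K b = A" "Cod K x = X"
  defines "e \<equiv> fixp ((A \<otimes> A) \<otimes> X) X (derivative_eqn A X k)"
  shows "e \<cdot> \<langle>\<langle>a, b\<rangle>, x\<rangle> = D k \<cdot> \<langle>\<langle>a, x\<rangle>, \<langle>b, e \<cdot> \<langle>\<langle>a, b\<rangle>, x\<rangle>\<rangle>\<rangle>"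
    and "e \<cdot> \<langle>\<langle>a, zero Z A\<rangle>, x\<rangle> = zero Z X"
    and "D e \<cdot> \<langle>\<langle>\<langle>a, zero Z A\<rangle>, x\<rangle>, \<langle>\<langle>zero Z A, b\<rangle>, zero Z X\<rangle>\<rangle> = e \<cdot> \<langle>\<langle>a, b\<rangle>, x\<rangle>"
proof -
  let ?P = "(A \<otimes> A) \<otimes> X" and ?f = "derivative_eqn A X k"
  note obs [simp] = k z
  have Z [simp]: "Z \<in> Obj K" using z(1,4) arr_Obj(1) by blast
  have e [simp]: "e \<in> Arr K" "Dom K e = ?P" "Cod K e = X"
    using k by (simp_all add: e_def)
  have "(?f \<cdot> \<langle>\<one> ?P, e\<rangle>) \<cdot> \<langle>\<langle>a, b\<rangle>, x\<rangle> = e \<cdot> \<langle>\<langle>a, b\<rangle>, x\<rangle>"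
    unfolding e_def by (subst fixp_unfold) simp_all
  then show "e \<cdot> \<langle>\<langle>a, b\<rangle>, x\<rangle> = D k \<cdot> \<langle>\<langle>a, x\<rangle>, \<langle>b, e \<cdot> \<langle>\<langle>a, b\<rangle>, x\<rangle>\<rangle>\<rangle>"
    by (simp add: derivative_eqn_Comp)

  obtain u where u: "u \<in> S" "Dom K u = \<Phi> ?P" "Cod K u = X"
    "u \<cdot> w ?P = ?f \<cdot> \<langle>\<pi>\<^sub>1 ?P (\<Phi> ?P), u \<cdot> \<pi>\<^sub>2 ?P (\<Phi> ?P)\<rangle>"
    using fold_ex[of ?f ?P X] Prod_Obj derivative_eqn_arr k by metis
  note us = u(1-3) S_simps[OF u(1)]
  define base where "base B a x = \<langle>\<langle>\<langle>a, zero B A\<rangle>, x\<rangle>, zero B (\<Phi> ?P)\<rangle>" for B a x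
  define dir where "dir B b y = \<langle>\<langle>\<langle>zero B A, b\<rangle>, zero B X\<rangle>, y\<rangle>" for B b y
  \<comment> \<open>The chain rule would add a second-order term; it disappears because the first-order direction of
    \<open>(a, x)\<close> is zero.\<close>
  have u_lin: "u \<cdot> D (w ?P) \<cdot> \<langle>base B a x, dir B b y\<rangle> = ?f \<cdot> \<langle>\<langle>\<langle>a, b\<rangle>, x\<rangle>, u \<cdot> y\<rangle>"
    if y [simp]: "B \<in> Obj K" "a \<in> Arr K" "b \<in> Arr K" "x \<in> Arr K" "y \<in> Arr K"
      "Dom K a = B" "Dom K b = B" "Dom K x = B" "Dom K y = B"
      "Cod K a = A" "Cod K b = A" "Cod K x = X" "Cod K y = \<Phi> ?P" for B a b x y
  proof -
    have "u \<cdot> D (w ?P) \<cdot> \<langle>base B a x, dir B b y\<rangle> = D (u \<cdot> w ?P) \<cdot> \<langle>base B a x, dir B b y\<rangle>"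
      using us by (simp add: base_def dir_def D_Comp)
    also have "\<dots> = D (D k) \<cdot> \<langle>\<langle>\<langle>a, x\<rangle>, \<langle>zero B A, zero B X\<rangle>\<rangle>, \<langle>\<langle>zero B A, zero B X\<rangle>, \<langle>b, u \<cdot> y\<rangle>\<rangle>\<rangle>"
      unfolding u(4) using us
      by (simp add: base_def dir_def derivative_eqn_def Let_def D_Comp)
    also have "\<dots> = D k \<cdot> \<langle>\<langle>a, x\<rangle>, \<langle>b, u \<cdot> y\<rangle>\<rangle>"
      using us by (intro D_D_vertical[where X = B]) (simp_all add: zero_Prod)
    finally show ?thesis using us by (simp add: derivative_eqn_Comp)
  qed
  let ?V = "?P \<otimes> \<Phi> ?P"
  let ?p = "\<pi>\<^sub>1 ?P (\<Phi> ?P)"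
  let ?c = "\<pi>\<^sub>1 A A \<cdot> \<pi>\<^sub>1 (A \<otimes> A) X \<cdot> ?p" and ?d = "\<pi>\<^sub>2 A A \<cdot> \<pi>\<^sub>1 (A \<otimes> A) X \<cdot> ?p"
    and ?y = "\<pi>\<^sub>2 (A \<otimes> A) X \<cdot> ?p"
  let ?G = "D (w ?P) \<cdot> \<langle>base ?V ?c ?y, dir ?V ?d (\<pi>\<^sub>2 ?P (\<Phi> ?P))\<rangle>"
  define s where "s = fixp ?P (\<Phi> ?P) ?G"
  have G: "?G \<in> Arr K" "Dom K ?G = ?V" "Cod K ?G = \<Phi> ?P"
    by (simp_all add: base_def dir_def)
  have s [simp]: "s \<in> Arr K" "Dom K s = ?P" "Cod K s = \<Phi> ?P"
    unfolding s_def using G by (simp_all del: Comp_arr)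
  have "u \<cdot> ?G = ?f \<cdot> \<langle>?p, u \<cdot> \<pi>\<^sub>2 ?P (\<Phi> ?P)\<rangle>"
    by (subst u_lin) simp_all
  then have es: "e = u \<cdot> s"
    unfolding e_def s_def using us G by (intro fixp_uniform[symmetric]) simp_all
  have s_eq: "s \<cdot> \<langle>\<langle>a, b\<rangle>, x\<rangle> = D (w ?P) \<cdot> \<langle>base B a x, dir B b (s \<cdot> \<langle>\<langle>a, b\<rangle>, x\<rangle>)\<rangle>"
    if [simp]: "B \<in> Obj K" "a \<in> Arr K" "b \<in> Arr K" "x \<in> Arr K" "Dom K a = B" "Dom K b = B"
      "Dom K x = B" "Cod K a = A" "Cod K b = A" "Cod K x = X" for B a b x
  proof -
    have "(?G \<cdot> \<langle>\<one> ?P, s\<rangle>) \<cdot> \<langle>\<langle>a, b\<rangle>, x\<rangle> = s \<cdot> \<langle>\<langle>a, b\<rangle>, x\<rangle>"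
      unfolding s_def using G by (subst fixp_unfold) simp_all
    then show ?thesis by (simp add: base_def dir_def)
  qed
  have unique: "y = y'"
    if "y = D (w ?P) \<cdot> \<langle>base Z a x, dir Z b y\<rangle>" "y' = D (w ?P) \<cdot> \<langle>base Z a x, dir Z b y'\<rangle>"
      "y \<in> hom K Z (\<Phi> ?P)" "y' \<in> hom K Z (\<Phi> ?P)"
      "a \<in> Arr K" "b \<in> Arr K" "x \<in> Arr K" "Dom K a = Z" "Dom K b = Z"
      "Dom K x = Z" "Cod K a = A" "Cod K b = A" "Cod K x = X" for y y' a b x
  proof -
    have "\<exists>!y. y \<in> hom K Z (\<Phi> ?P) \<and> D (w ?P) \<cdot> \<langle>base Z a x, dir Z b y\<rangle> = y"
      unfolding base_def dir_def
      by (rule w_derivative_solution_unique) (use that(5-) in simp_all)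
    then show ?thesis using that(3,4) that(1,2)[symmetric] by blast
  qed

  have "zero Z (\<Phi> ?P) = D (w ?P) \<cdot> \<langle>base Z a x, zero Z (Dom K (w ?P))\<rangle>"
    by (subst D_zero_vector) (simp_all add: base_def)
  then have "zero Z (\<Phi> ?P) = D (w ?P) \<cdot> \<langle>base Z a x, dir Z (zero Z A) (zero Z (\<Phi> ?P))\<rangle>"
    by (simp add: dir_def zero_Prod)
  then have "s \<cdot> \<langle>\<langle>a, zero Z A\<rangle>, x\<rangle> = zero Z (\<Phi> ?P)"
    by (intro unique[OF s_eq[of Z a "zero Z A" x]]) (simp_all add: hom_iff)
  then show "e \<cdot> \<langle>\<langle>a, zero Z A\<rangle>, x\<rangle> = zero Z X"
    using us by (simp add: es)

  let ?b = "\<langle>\<langle>a, zero Z A\<rangle>, x\<rangle>" and ?v = "\<langle>\<langle>zero Z A, b\<rangle>, zero Z X\<rangle>"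
  let ?c = "\<pi>\<^sub>1 A A \<cdot> \<pi>\<^sub>1 (A \<otimes> A) X" and ?d = "\<pi>\<^sub>2 A A \<cdot> \<pi>\<^sub>1 (A \<otimes> A) X"
    and ?y = "\<pi>\<^sub>2 (A \<otimes> A) X"
  have "s = D (w ?P) \<cdot> \<langle>base ?P ?c ?y, dir ?P ?d s\<rangle>"
    using s_eq[of ?P ?c ?d ?y] by simp
  then have "D s \<cdot> \<langle>?b, ?v\<rangle> = D (D (w ?P) \<cdot> \<langle>base ?P ?c ?y, dir ?P ?d s\<rangle>) \<cdot> \<langle>?b, ?v\<rangle>"
    by (rule arg_cong)
  also have "\<dots> = D (D (w ?P)) \<cdot> \<langle>\<langle>base Z a x, dir Z (zero Z A) (s \<cdot> ?b)\<rangle>,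
      \<langle>\<langle>\<langle>\<langle>zero Z A, zero Z A\<rangle>, zero Z X\<rangle>, zero Z (\<Phi> ?P)\<rangle>, dir Z b (D s \<cdot> \<langle>?b, ?v\<rangle>)\<rangle>\<rangle>"
    by (simp add: base_def dir_def D_Comp)
  also have "\<dots> = D (w ?P) \<cdot> \<langle>base Z a x, dir Z b (D s \<cdot> \<langle>?b, ?v\<rangle>)\<rangle>"
    by (intro D_D_vertical[where X = Z]) (simp_all add: base_def dir_def zero_Prod)
  finally have "D s \<cdot> \<langle>?b, ?v\<rangle> = s \<cdot> \<langle>\<langle>a, b\<rangle>, x\<rangle>"
    by (rule unique[OF _ s_eq[of Z a b x]]) (simp_all add: hom_iff)
  then show "D e \<cdot> \<langle>?b, ?v\<rangle> = e \<cdot> \<langle>\<langle>a, b\<rangle>, x\<rangle>"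
    using us by (simp add: es D_Comp)
qed


text \<open>
  Two solutions \<open>y\<close>, \<open>z\<close> of the differentiated equation over the base point \<open>t a\<close> agree if they vanish at
  \<open>b = 0\<close> and are their own derivative there, since \<open>t a + y\<close> and \<open>t a + z\<close> are then first-order
  solutions of the fixpoint equation of \<open>w\<close>.
\<close>

lemma first_order_solution_unique:
  fixes A
  defines "b \<equiv> \<langle>\<pi>\<^sub>1 A A, zero (A \<otimes> A) A\<rangle>" and "v \<equiv> \<langle>zero (A \<otimes> A) A, \<pi>\<^sub>2 A A\<rangle>"
    and "p \<equiv> \<langle>\<pi>\<^sub>1 A A, point A \<cdot> \<pi>\<^sub>1 A A\<rangle>"
  assumes A: "A \<in> Obj K"
    and y: "y \<in> hom K (A \<otimes> A) (\<Phi> A)" "y \<cdot> b = zero (A \<otimes> A) (\<Phi> A)" "D y \<cdot> \<langle>b, v\<rangle> = y"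
      "D (w A) \<cdot> \<langle>p, \<langle>\<pi>\<^sub>2 A A, y\<rangle>\<rangle> = y"
    and z: "z \<in> hom K (A \<otimes> A) (\<Phi> A)" "z \<cdot> b = zero (A \<otimes> A) (\<Phi> A)" "D z \<cdot> \<langle>b, v\<rangle> = z"
      "D (w A) \<cdot> \<langle>p, \<langle>\<pi>\<^sub>2 A A, z\<rangle>\<rangle> = z"
  shows "y = z"
proof -
  let ?T = "A \<otimes> A"
  define h where "h y = add (point A \<cdot> \<pi>\<^sub>1 A A) y" for y
  define step where "step h = add (w A \<cdot> \<langle>\<pi>\<^sub>1 A A, h \<cdot> b\<rangle>)
      (D (w A) \<cdot> \<langle>\<langle>\<pi>\<^sub>1 A A, h \<cdot> b\<rangle>, \<langle>\<pi>\<^sub>2 A A, D h \<cdot> \<langle>b, v\<rangle>\<rangle>\<rangle>)" for h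
  have bv [simp]: "b \<in> Arr K" "Dom K b = ?T" "Cod K b = ?T" "v \<in> Arr K" "Dom K v = ?T" "Cod K v = ?T"
    "\<pi>\<^sub>1 A A \<cdot> b = \<pi>\<^sub>1 A A" "\<pi>\<^sub>1 A A \<cdot> v = zero ?T A"
    using A by (simp_all add: b_def v_def)
  have h: "h y \<in> hom K ?T (\<Phi> A) \<and> step (h y) = h y \<and> D (h y) \<cdot> \<langle>b, v\<rangle> = y"
    if y: "y \<in> hom K ?T (\<Phi> A)" "y \<cdot> b = zero ?T (\<Phi> A)" "D y \<cdot> \<langle>b, v\<rangle> = y"
      "D (w A) \<cdot> \<langle>p, \<langle>\<pi>\<^sub>2 A A, y\<rangle>\<rangle> = y" for y
  proof -
    have yA: "y \<in> Arr K" "Dom K y = ?T" "Cod K y = \<Phi> A" using y(1) by (simp_all add: hom_iff)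
    have base: "h y \<cdot> b = point A \<cdot> \<pi>\<^sub>1 A A"
      using A yA by (simp add: h_def y(2))
    have "D (point A \<cdot> \<pi>\<^sub>1 A A) \<cdot> \<langle>b, v\<rangle> = D (point A) \<cdot> \<langle>\<pi>\<^sub>1 A A, zero ?T (Dom K (point A))\<rangle>"
      using A by (simp add: D_Comp)
    also have "\<dots> = zero ?T (\<Phi> A)"
      using A by (subst D_zero_vector) simp_all
    finally have der: "D (h y) \<cdot> \<langle>b, v\<rangle> = y"
      using A yA by (simp add: h_def y(3))
    have "step (h y) = h y"
      unfolding step_def base der using A y(4)
      by (simp add: w_point_Comp p_def) (simp add: h_def)
    then show ?thesis using der A yA by (simp add: h_def hom_iff)
  qed
  have "\<exists>!h. h \<in> hom K ?T (\<Phi> A) \<and> step h = h"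
    using w_first_order_solution_unique[OF A] by (simp add: step_def b_def v_def)
  then have "h y = h z" using h[OF y] h[OF z] by blast
  then show ?thesis using h[OF y] h[OF z] by metis
qed

lemma D_point:
  assumes A: "A \<in> Obj K"
  shows "D (point A) = fixp ((A \<otimes> A) \<otimes> \<Phi> A) (\<Phi> A) (derivative_eqn A (\<Phi> A) (w A))
    \<cdot> \<langle>\<one> (A \<otimes> A), point A \<cdot> \<pi>\<^sub>1 A A\<rangle>"
    (is "_ = ?e \<cdot> _")
proof (rule first_order_solution_unique[OF A])
  let ?T = "A \<otimes> A" and ?X = "\<Phi> A"
  let ?b = "\<langle>\<pi>\<^sub>1 A A, zero ?T A\<rangle>" and ?v = "\<langle>zero ?T A, \<pi>\<^sub>2 A A\<rangle>"
  let ?x = "point A \<cdot> \<pi>\<^sub>1 A A"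
  note [simp] = A
  have e [simp]: "?e \<in> Arr K" "Dom K ?e = ?T \<otimes> ?X" "Cod K ?e = ?X"
    by simp_all
  have vanish: "D (point A) \<cdot> ?b = zero ?T ?X"
    using D_zero_vector[of "point A" "\<pi>\<^sub>1 A A" ?T] by simp
  show "D (point A) \<in> hom K ?T ?X" "?e \<cdot> \<langle>\<one> ?T, ?x\<rangle> \<in> hom K ?T ?X"
    by (simp_all add: hom_iff)
  show "D (point A) \<cdot> ?b = zero ?T ?X" by (rule vanish)
  show "D (D (point A)) \<cdot> \<langle>?b, ?v\<rangle> = D (point A)"
    using D_D_vertical[of "point A" "\<pi>\<^sub>1 A A" "zero ?T A" "\<pi>\<^sub>2 A A" ?T] by simp
  have "D (w A \<cdot> \<langle>\<one> A, point A\<rangle>) \<cdot> \<langle>\<pi>\<^sub>1 A A, \<pi>\<^sub>2 A A\<rangle> = D (w A) \<cdot> \<langle>\<langle>\<pi>\<^sub>1 A A, ?x\<rangle>, \<langle>\<pi>\<^sub>2 A A, D (point A)\<rangle>\<rangle>"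
    by (subst D_Comp) simp_all
  then show "D (w A) \<cdot> \<langle>\<langle>\<pi>\<^sub>1 A A, ?x\<rangle>, \<langle>\<pi>\<^sub>2 A A, D (point A)\<rangle>\<rangle> = D (point A)"
    by simp
  have w: "w A \<in> Arr K" "Dom K (w A) = A \<otimes> ?X" "Cod K (w A) = ?X" "A \<in> Obj K" "?X \<in> Obj K"
    and args: "\<pi>\<^sub>1 A A \<in> Arr K" "\<pi>\<^sub>2 A A \<in> Arr K" "?x \<in> Arr K" "Dom K (\<pi>\<^sub>1 A A) = ?T"
      "Dom K (\<pi>\<^sub>2 A A) = ?T" "Dom K ?x = ?T" "Cod K (\<pi>\<^sub>1 A A) = A" "Cod K (\<pi>\<^sub>2 A A) = A" "Cod K ?x = ?X"
    by simp_all
  note e_props = fixp_derivative_eqn[OF w args]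
  show "(?e \<cdot> \<langle>\<one> ?T, ?x\<rangle>) \<cdot> ?b = zero ?T ?X"
    using e_props(2) by simp
  have "D (?e \<cdot> \<langle>\<one> ?T, ?x\<rangle>) \<cdot> \<langle>?b, ?v\<rangle>
      = D ?e \<cdot> \<langle>\<langle>?b, ?x\<rangle>, \<langle>?v, D (point A) \<cdot> ?b\<rangle>\<rangle>"
    by (simp add: D_Comp)
  then show "D (?e \<cdot> \<langle>\<one> ?T, ?x\<rangle>) \<cdot> \<langle>?b, ?v\<rangle> = ?e \<cdot> \<langle>\<one> ?T, ?x\<rangle>"
    using e_props(3) by (simp add: vanish)
  show "D (w A) \<cdot> \<langle>\<langle>\<pi>\<^sub>1 A A, ?x\<rangle>, \<langle>\<pi>\<^sub>2 A A, ?e \<cdot> \<langle>\<one> ?T, ?x\<rangle>\<rangle>\<rangle> = ?e \<cdot> \<langle>\<one> ?T, ?x\<rangle>"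
    using e_props(1)[symmetric] by simp
qed

lemma fixp_w:
  assumes "A \<in> Obj K"
  shows "fixp A (\<Phi> A) (w A) = point A"
proof -
  have "fixp A (\<Phi> A) (w A) = point A \<cdot> \<one> A"
    using assms fixp_unfold[of "w A" A "\<Phi> A"] by (intro point_unique) simp_all
  then show ?thesis using assms by simp
qed

lemma tangent_interchange:
  assumes f: "f \<in> Arr K" "Dom K f = A \<otimes> X" "Cod K f = X" "A \<in> Obj K" "X \<in> Obj K"
  defines "p \<equiv> \<pi>\<^sub>1 (A \<otimes> A) (X \<otimes> X)" and "q \<equiv> \<pi>\<^sub>2 (A \<otimes> A) (X \<otimes> X)"
  shows "tangent_map K D f \<cdot> interchange K A A X X =
    \<langle>f \<cdot> \<langle>\<pi>\<^sub>1 A A \<cdot> p, \<pi>\<^sub>1 X X \<cdot> q\<rangle>,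
     D f \<cdot> \<langle>\<langle>\<pi>\<^sub>1 A A \<cdot> p, \<pi>\<^sub>1 X X \<cdot> q\<rangle>, \<langle>\<pi>\<^sub>2 A A \<cdot> p, \<pi>\<^sub>2 X X \<cdot> q\<rangle>\<rangle>\<rangle>"
  using f by (simp add: tangent_map_def interchange_def Let_def p_def q_def)

lemma fixp_tangent_w:
  assumes A: "A \<in> Obj K"
  shows "fixp (A \<otimes> A) (\<Phi> A \<otimes> \<Phi> A) (tangent_map K D (w A) \<cdot> interchange K A A (\<Phi> A) (\<Phi> A))
    = \<langle>point A \<cdot> \<pi>\<^sub>1 A A, D (point A)\<rangle>"
proof -
  let ?T = "A \<otimes> A" and ?X = "\<Phi> A"
  note [simp] = A
  let ?f = "w A \<cdot> \<langle>\<pi>\<^sub>1 A A \<cdot> \<pi>\<^sub>1 ?T ?X, \<pi>\<^sub>2 ?T ?X\<rangle>" and ?g = "derivative_eqn A ?X (w A)"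
  let ?p = "\<pi>\<^sub>1 ?T (?X \<otimes> ?X)" and ?q = "\<pi>\<^sub>2 ?T (?X \<otimes> ?X)"
  have f: "fixp ?T ?X ?f = point A \<cdot> \<pi>\<^sub>1 A A"
    using fixp_natural[of "\<pi>\<^sub>1 A A" ?T A ?X "w A"] by (simp add: fixp_w)
  have "tangent_map K D (w A) \<cdot> interchange K A A ?X ?X =
    \<langle>?f \<cdot> \<langle>?p, \<pi>\<^sub>1 ?X ?X \<cdot> ?q\<rangle>, ?g \<cdot> \<langle>\<langle>?p, \<pi>\<^sub>1 ?X ?X \<cdot> ?q\<rangle>, \<pi>\<^sub>2 ?X ?X \<cdot> ?q\<rangle>\<rangle>"
    by (simp add: tangent_interchange derivative_eqn_def Let_def)
  then have "fixp ?T (?X \<otimes> ?X) (tangent_map K D (w A) \<cdot> interchange K A A ?X ?X)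
      = \<langle>fixp ?T ?X ?f, fixp (?T \<otimes> ?X) ?X ?g \<cdot> \<langle>\<one> ?T, fixp ?T ?X ?f\<rangle>\<rangle>"
    by (simp only:) (rule fixp_triangular, simp_all)
  then show ?thesis unfolding f D_point[OF A] .
qed

text \<open>
  The fold \<open>u\<close> of \<open>f\<close> is linear, so its tangent map is \<open>u \<times> u\<close>, which lies in \<open>S\<close>. Uniformity along
  it carries the rule from \<open>w\<close> to \<open>f\<close>.
\<close>

lemma fixp_tangent:
  assumes f: "f \<in> Arr K" "Dom K f = A \<otimes> X" "Cod K f = X" "A \<in> Obj K" "X \<in> Obj K"
  shows "tangent_map K D (fixp A X f)
    = fixp (A \<otimes> A) (X \<otimes> X) (tangent_map K D f \<cdot> interchange K A A X X)"
proof -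
  note [simp] = f
  let ?T = "A \<otimes> A" and ?Y = "\<Phi> A"
  obtain u where u: "u \<in> S" "Dom K u = ?Y" "Cod K u = X"
    "u \<cdot> w A = f \<cdot> \<langle>\<pi>\<^sub>1 A ?Y, u \<cdot> \<pi>\<^sub>2 A ?Y\<rangle>" "fixp A X f = u \<cdot> point A"
    using fold_ex[OF f] by blast
  note us = u(1-3) S_simps[OF u(1)]
  let ?h = "\<langle>u \<cdot> \<pi>\<^sub>1 ?Y ?Y, u \<cdot> \<pi>\<^sub>2 ?Y ?Y\<rangle>"
  have h: "?h \<in> S" using us by (simp add: S_Tuple S_Comp S_Proj1 S_Proj2)
  have D_u: "D (u \<cdot> w A) = u \<cdot> D (w A)" "D (u \<cdot> point A) = u \<cdot> D (point A)"
    using us linear_D[OF S_linear] by simp_all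
  let ?p = "\<pi>\<^sub>1 ?T (?Y \<otimes> ?Y)" and ?q = "\<pi>\<^sub>2 ?T (?Y \<otimes> ?Y)"
  let ?a = "\<langle>\<pi>\<^sub>1 A A \<cdot> ?p, \<pi>\<^sub>1 ?Y ?Y \<cdot> ?q\<rangle>" and ?b = "\<langle>\<pi>\<^sub>2 A A \<cdot> ?p, \<pi>\<^sub>2 ?Y ?Y \<cdot> ?q\<rangle>"
  have "?h \<cdot> (tangent_map K D (w A) \<cdot> interchange K A A ?Y ?Y) = \<langle>(u \<cdot> w A) \<cdot> ?a, D (u \<cdot> w A) \<cdot> \<langle>?a, ?b\<rangle>\<rangle>"
    using us by (simp add: tangent_interchange D_u)
  also have "\<dots> = (tangent_map K D f \<cdot> interchange K A A X X) \<cdot> \<langle>?p, ?h \<cdot> ?q\<rangle>"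
    unfolding u(4) using us by (simp add: tangent_interchange D_Comp)
  finally have uniform: "?h \<cdot> (tangent_map K D (w A) \<cdot> interchange K A A ?Y ?Y)
      = (tangent_map K D f \<cdot> interchange K A A X X) \<cdot> \<langle>?p, ?h \<cdot> ?q\<rangle>" .
  have h_arr: "Dom K ?h = ?Y \<otimes> ?Y" "Cod K ?h = X \<otimes> X"
    using us by simp_all
  have arr: "tangent_map K D g \<cdot> interchange K A A Z Z \<in> Arr K"
    "Dom K (tangent_map K D g \<cdot> interchange K A A Z Z) = ?T \<otimes> (Z \<otimes> Z)"
    "Cod K (tangent_map K D g \<cdot> interchange K A A Z Z) = Z \<otimes> Z"
    if "g \<in> Arr K" "Dom K g = A \<otimes> Z" "Cod K g = Z" "Z \<in> Obj K" for g Z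
    using that by (simp_all add: tangent_interchange)
  have w: "w A \<in> Arr K" "Dom K (w A) = A \<otimes> ?Y" "Cod K (w A) = ?Y" "?Y \<in> Obj K" "?T \<in> Obj K"
    by simp_all
  have "?h \<cdot> fixp ?T (?Y \<otimes> ?Y) (tangent_map K D (w A) \<cdot> interchange K A A ?Y ?Y)
      = fixp ?T (X \<otimes> X) (tangent_map K D f \<cdot> interchange K A A X X)"
    by (rule fixp_uniform[OF h h_arr arr[OF w(1-4)] arr[OF f(1-3,5)] w(5) uniform])
  moreover have "tangent_map K D (fixp A X f) = ?h \<cdot> \<langle>point A \<cdot> \<pi>\<^sub>1 A A, D (point A)\<rangle>"
    using us by (simp add: u(5) D_u(2) tangent_map_def)
  ultimately show ?thesis
    unfolding fixp_tangent_w[OF f(4)] by simp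
qed

lemma tangent_fixpoint_rule: "tangent_fixpoint_rule K D fixp"
  unfolding tangent_fixpoint_rule_def tangent_obj_def
  by (simp add: fixp_tangent hom_iff)

lemma differential_fixpoint_category:
  "cartesian_differential_fixpoint_category K zero add D fixp"
proof
  fix A X f
  assume "A \<in> Obj K" "X \<in> Obj K" "f \<in> hom K (A \<otimes> X) X"
  then have f: "f \<in> Arr K" "Dom K f = A \<otimes> X" "Cod K f = X" "A \<in> Obj K" "X \<in> Obj K"
    by (simp_all add: hom_iff)
  show "fixp A X f \<in> hom K A X"
    using f by (simp add: hom_iff)
  show "f \<cdot> \<langle>\<one> A, fixp A X f\<rangle> = fixp A X f"
    using f by (rule fixp_unfold)
  show "D (fixp A X f) =
      \<pi>\<^sub>2 X X \<cdot> fixp (tangent_obj K A) (tangent_obj K X) (tangent_map K D f \<cdot> interchange K A A X X)"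
    using f by (simp add: tangent_obj_def fixp_tangent[symmetric]) (simp add: tangent_map_def)
next
  fix X g A B f
  assume "X \<in> Obj K" "g \<in> hom K A B" "f \<in> hom K (B \<otimes> X) X"
  then show "fixp B X f \<cdot> g = fixp A X (f \<cdot> prod_map K g (\<one> X))"
    using fixp_natural[of g A B X f] by (auto simp: hom_iff prod_map_def)
qed

end

section \<open>The co-Kleisli category\<close>

locale cartesian_comonad = cartesian_category C + comonad C F
  for C :: "('o, 'm, 'z) cartesian_data_scheme" (structure)
    and F :: "('o, 'm, 'y) comonad_data_scheme"
begin

abbreviation K where "K \<equiv> coKleisli C F"

lemma coKleisli_simps [simp]:
  "Obj K = Obj C" "Dom K x = fst x" "Cod K x = Cod C (snd x)" "\<one>\<^bsub>K\<^esub> A = (A, \<epsilon>\<^bsub>F\<^esub> A)"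
  "y \<cdot>\<^bsub>K\<^esub> x = (fst x, snd y \<cdot> FMap F (snd x) \<cdot> \<delta>\<^bsub>F\<^esub> (fst x))"
  "A \<otimes>\<^bsub>K\<^esub> B = A \<otimes> B"
  "\<pi>\<^sub>1\<^bsub>K\<^esub> A B = (A \<otimes> B, \<pi>\<^sub>1 A B \<cdot> \<epsilon>\<^bsub>F\<^esub> (A \<otimes> B))"
  "\<pi>\<^sub>2\<^bsub>K\<^esub> A B = (A \<otimes> B, \<pi>\<^sub>2 A B \<cdot> \<epsilon>\<^bsub>F\<^esub> (A \<otimes> B))"
  "\<langle>x, y\<rangle>\<^bsub>K\<^esub> = (fst x, \<langle>snd x, snd y\<rangle>)"
  by (simp_all add: coKleisli_def)

lemma coKleisli_Arr: "x \<in> Arr K \<longleftrightarrow> fst x \<in> Obj C \<and> snd x \<in> Arr C \<and> Dom C (snd x) = FObj F (fst x)"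
  by (auto simp: coKleisli_def)

lemma functor_arr [simp]:
  assumes "f \<in> Arr C"
  shows "FMap F f \<in> Arr C" "Dom C (FMap F f) = FObj F (Dom C f)" "Cod C (FMap F f) = FObj F (Cod C f)"
  using FMap_hom[of f "Dom C f" "Cod C f"] assms by (auto simp: hom_iff)

lemma comonad_arr [simp]:
  assumes "A \<in> Obj C"
  shows "FObj F A \<in> Obj C"
    "\<delta>\<^bsub>F\<^esub> A \<in> Arr C" "Dom C (\<delta>\<^bsub>F\<^esub> A) = FObj F A" "Cod C (\<delta>\<^bsub>F\<^esub> A) = FObj F (FObj F A)"
    "\<epsilon>\<^bsub>F\<^esub> A \<in> Arr C" "Dom C (\<epsilon>\<^bsub>F\<^esub> A) = FObj F A" "Cod C (\<epsilon>\<^bsub>F\<^esub> A) = A"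
  using FObj_Obj[OF assms] Comult_hom[OF assms] Counit_hom[OF assms] by (auto simp: hom_iff)

lemma free_map_Comp:
  assumes "g \<in> Arr C" "x \<in> Arr K" "Cod K x = Dom C g"
  shows "free_map C F g \<cdot>\<^bsub>K\<^esub> x = (fst x, g \<cdot> snd x)"
proof -
  obtain A s where x: "x = (A, s)" by (cases x)
  have s: "A \<in> Obj C" "s \<in> Arr C" "Dom C s = FObj F A" "Cod C s = Dom C g"
    using assms by (auto simp: x coKleisli_Arr)
  have "\<epsilon>\<^bsub>F\<^esub> (Dom C g) \<cdot> FMap F s \<cdot> \<delta>\<^bsub>F\<^esub> A = (\<epsilon>\<^bsub>F\<^esub> (Dom C g) \<cdot> FMap F s) \<cdot> \<delta>\<^bsub>F\<^esub> A"
    using s assms(1) by (subst Comp_assoc_arr) auto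
  also have "\<dots> = s \<cdot> \<epsilon>\<^bsub>F\<^esub> (FObj F A) \<cdot> \<delta>\<^bsub>F\<^esub> A"
    using s Counit_natural[of s "FObj F A" "Dom C g"] by (simp add: hom_iff)
  also have "\<dots> = s" using s by (simp add: Counit_Comult)
  finally show ?thesis using s assms(1) by (simp add: x free_map_def)
qed

lemma Comp_free_map:
  assumes "g \<in> Arr C" "x \<in> Arr K" "Dom K x = Cod C g"
  shows "x \<cdot>\<^bsub>K\<^esub> free_map C F g = (Dom C g, snd x \<cdot> FMap F g)"
proof -
  have "FMap F (g \<cdot> \<epsilon>\<^bsub>F\<^esub> (Dom C g)) = FMap F g \<cdot> FMap F (\<epsilon>\<^bsub>F\<^esub> (Dom C g))"
    by (rule FMap_Comp[of _ "FObj F (Dom C g)" "Dom C g" _ "Cod C g"])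
      (use assms(1) in \<open>auto simp: hom_iff\<close>)
  then show ?thesis
    using assms by (simp add: free_map_def FMap_Counit_Comult coKleisli_Arr)
qed

lemma free_map_arr [simp]:
  assumes "g \<in> Arr C"
  shows "free_map C F g \<in> Arr K" "fst (free_map C F g) = Dom C g"
    "Dom C (snd (free_map C F g)) = FObj F (Dom C g)" "Cod C (snd (free_map C F g)) = Cod C g"
  using assms by (auto simp: free_map_def coKleisli_Arr)

lemma free_map_Comp_free_map:
  assumes "g \<in> Arr C" "h \<in> Arr C" "Dom C g = Cod C h"
  shows "free_map C F g \<cdot>\<^bsub>K\<^esub> free_map C F h = free_map C F (g \<cdot> h)"
proof -
  have "free_map C F g \<cdot>\<^bsub>K\<^esub> free_map C F h = (Dom C h, g \<cdot> snd (free_map C F h))"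
    using assms free_map_Comp[OF assms(1) free_map_arr(1)[OF assms(2)]]
    by (simp del: coKleisli_simps(5))
  also have "\<dots> = free_map C F (g \<cdot> h)" using assms by (simp add: free_map_def)
  finally show ?thesis .
qed

lemma prod_map_Idt:
  assumes "A \<in> Obj C" "u \<in> Arr C" "Dom C u = X"
  shows "prod_map C (\<one> A) u = \<langle>\<pi>\<^sub>1 A X, u \<cdot> \<pi>\<^sub>2 A X\<rangle>"
proof -
  have "X \<in> Obj C" using assms by auto
  then show ?thesis using assms by (simp add: prod_map_def)
qed

lemma free_map_prod_map:
  assumes "A \<in> Obj C" "u \<in> Arr C" "Dom C u = X"
  shows "free_map C F (prod_map C (\<one> A) u)
    = \<langle>\<pi>\<^sub>1\<^bsub>K\<^esub> A X, free_map C F u \<cdot>\<^bsub>K\<^esub> \<pi>\<^sub>2\<^bsub>K\<^esub> A X\<rangle>\<^bsub>K\<^esub>"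
proof -
  have X: "X \<in> Obj C" using assms by auto
  then have "free_map C F u \<cdot>\<^bsub>K\<^esub> \<pi>\<^sub>2\<^bsub>K\<^esub> A X = (A \<otimes> X, u \<cdot> \<pi>\<^sub>2 A X \<cdot> \<epsilon>\<^bsub>F\<^esub> (A \<otimes> X))"
    using assms by (subst free_map_Comp) (simp_all add: coKleisli_Arr)
  then show ?thesis
    using assms X by (simp add: free_map_def prod_map_Idt del: coKleisli_simps(5))
qed

lemma algebra_map_iff:
  assumes "A \<in> Obj C" "f \<in> hom K (A \<otimes> X) X" "w \<in> hom C (FObj F (A \<otimes> Y)) Y" "u \<in> hom C Y X"
  shows "free_map C F u \<cdot>\<^bsub>K\<^esub> (A \<otimes> Y, w)
      = f \<cdot>\<^bsub>K\<^esub> \<langle>\<pi>\<^sub>1\<^bsub>K\<^esub> A Y, free_map C F u \<cdot>\<^bsub>K\<^esub> \<pi>\<^sub>2\<^bsub>K\<^esub> A Y\<rangle>\<^bsub>K\<^esub>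
    \<longleftrightarrow> u \<cdot> w = snd f \<cdot> FMap F (prod_map C (\<one> A) u)"
proof -
  have u: "u \<in> Arr C" "Dom C u = Y" "Cod C u = X" "Y \<in> Obj C" "X \<in> Obj C"
    using assms(4) by (auto simp: hom_iff)
  have p: "prod_map C (\<one> A) u \<in> Arr C" "Dom C (prod_map C (\<one> A) u) = A \<otimes> Y"
    "Cod C (prod_map C (\<one> A) u) = A \<otimes> X"
    using u assms(1) by (simp_all add: prod_map_Idt)
  have "free_map C F u \<cdot>\<^bsub>K\<^esub> (A \<otimes> Y, w) = (A \<otimes> Y, u \<cdot> w)"
    using u assms(1,3) by (subst free_map_Comp) (auto simp: coKleisli_Arr hom_iff)
  moreover have "f \<cdot>\<^bsub>K\<^esub> free_map C F (prod_map C (\<one> A) u) = (A \<otimes> Y, snd f \<cdot> FMap F (prod_map C (\<one> A) u))"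
    using p assms(2) by (subst Comp_free_map) (auto simp: hom_iff)
  ultimately show ?thesis
    by (simp add: free_map_prod_map[OF assms(1) u(1,2), symmetric] del: coKleisli_simps)
qed

end

section \<open>Bifree fixpoints satisfy the tangent-fixpoint rule\<close>

theorem mainTheorem4:
  fixes C :: "('o, 'm) cartesian_data"
    and F :: "('o, 'm) comonad_data"
    and \<Phi> :: "'o \<Rightarrow> 'o" and w :: "'o \<Rightarrow> 'm"
    and zero :: "'o \<Rightarrow> 'o \<Rightarrow> 'o \<times> 'm"
    and add :: "'o \<times> 'm \<Rightarrow> 'o \<times> 'm \<Rightarrow> 'o \<times> 'm"
    and D :: "'o \<times> 'm \<Rightarrow> 'o \<times> 'm"
  assumes "cartesian_category C"
    and "comonad C F"
    and "\<And>A. A \<in> Obj C \<Longrightarrow> bifree_algebra C (times_functor C F A) (\<Phi> A) (w A)"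
    and "cartesian_differential_category (coKleisli C F) zero add D"
    and "\<And>g. g \<in> Arr C \<Longrightarrow> linear_map (coKleisli C F) D (free_map C F g)"
  shows "tangent_fixpoint_rule (coKleisli C F) D (bifree_fixp C F \<Phi> w) \<and>
    cartesian_differential_fixpoint_category (coKleisli C F) zero add D (bifree_fixp C F \<Phi> w)"
proof -
  interpret cartesian_comonad C F
    using assms(1,2) by (simp add: cartesian_comonad_def)
  interpret K: cartesian_differential_category K zero add D by fact
  let ?S = "free_map C F ` Arr C" and ?\<eta> = "\<lambda>A. (A, \<one>\<^bsub>C\<^esub> (FObj F A))"
    and ?lift = "\<lambda>k. free_map C F (snd k)" and ?w = "bifree_map C \<Phi> w"
    and ?T = "\<lambda>A u. prod_map C (\<one>\<^bsub>C\<^esub> A) u"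
  have \<Phi>: "\<Phi> A \<in> Obj C" "w A \<in> hom C (FObj F (A \<otimes>\<^bsub>C\<^esub> \<Phi> A)) (\<Phi> A)"
    and initial: "X \<in> Obj C \<Longrightarrow> x \<in> hom C (FObj F (A \<otimes>\<^bsub>C\<^esub> X)) X \<Longrightarrow>
      \<exists>!u. u \<in> hom C (\<Phi> A) X \<and> u \<cdot>\<^bsub>C\<^esub> w A = x \<cdot>\<^bsub>C\<^esub> FMap F (?T A u)"
    if "A \<in> Obj C" for A X x
    using assms(3)[OF that]
    by (simp_all add: bifree_algebra_def initial_algebra_def times_functor_def)
  \<comment> \<open>Finality, with the inverse of \<open>w A\<close> moved to the other side.\<close>
  have final: "\<exists>!s. s \<in> hom C E (\<Phi> A) \<and> w A \<cdot>\<^bsub>C\<^esub> FMap F (?T A s) \<cdot>\<^bsub>C\<^esub> x = s"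
    if A: "A \<in> Obj C" and E: "E \<in> Obj C" "x \<in> hom C E (FObj F (A \<otimes>\<^bsub>C\<^esub> E))" for A E x
  proof -
    obtain v where v: "v \<in> hom C (\<Phi> A) (FObj F (A \<otimes>\<^bsub>C\<^esub> \<Phi> A))"
      "v \<cdot>\<^bsub>C\<^esub> w A = \<one>\<^bsub>C\<^esub> (FObj F (A \<otimes>\<^bsub>C\<^esub> \<Phi> A))" "w A \<cdot>\<^bsub>C\<^esub> v = \<one>\<^bsub>C\<^esub> (\<Phi> A)"
      and ex1: "\<exists>!s. s \<in> hom C E (\<Phi> A) \<and> v \<cdot>\<^bsub>C\<^esub> s = FMap F (?T A s) \<cdot>\<^bsub>C\<^esub> x"
      using assms(3)[OF A] E by (auto simp: bifree_algebra_def final_coalgebra_def times_functor_def)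
    have "v \<cdot>\<^bsub>C\<^esub> s = FMap F (?T A s) \<cdot>\<^bsub>C\<^esub> x \<longleftrightarrow> w A \<cdot>\<^bsub>C\<^esub> FMap F (?T A s) \<cdot>\<^bsub>C\<^esub> x = s"
      if s: "s \<in> hom C E (\<Phi> A)" for s
    proof -
      have "FMap F (?T A s) \<cdot>\<^bsub>C\<^esub> x \<in> hom C E (FObj F (A \<otimes>\<^bsub>C\<^esub> \<Phi> A))" (is "?y \<in> _")
        using A E \<Phi>[OF A] s by (simp add: hom_iff prod_map_Idt)
      then have "v \<cdot>\<^bsub>C\<^esub> w A \<cdot>\<^bsub>C\<^esub> ?y = ?y" "w A \<cdot>\<^bsub>C\<^esub> v \<cdot>\<^bsub>C\<^esub> s = s"
        using Comp_assoc[of ?y _ _ "w A" _ v] Comp_assoc[of s _ _ v _ "w A"] s v \<Phi>[OF A]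
          Idt_Comp by metis+
      then show ?thesis by metis
    qed
    then show ?thesis using ex1 by (metis (no_types, lifting))
  qed

  interpret differential_coKleisli K zero add D ?S "FObj F" ?\<eta> ?lift \<Phi> ?w
  proof
    fix s assume "s \<in> ?S" then show "linear_map K D s" using assms(5) by auto
  next
    fix r s assume "r \<in> ?S" "s \<in> ?S" "Dom K r = Cod K s"
    then obtain g h where gh: "g \<in> Arr C" "h \<in> Arr C" "r = free_map C F g" "s = free_map C F h"
      "Dom C g = Cod C h" by auto
    then have "r \<cdot>\<^bsub>K\<^esub> s = free_map C F (g \<cdot>\<^bsub>C\<^esub> h)"
      using free_map_Comp_free_map by blast
    moreover have "g \<cdot>\<^bsub>C\<^esub> h \<in> Arr C" using gh by simp
    ultimately show "r \<cdot>\<^bsub>K\<^esub> s \<in> ?S" by blast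
  next
    fix r s assume "r \<in> ?S" "s \<in> ?S" "Dom K r = Dom K s"
    then obtain g h where gh: "g \<in> Arr C" "h \<in> Arr C" "r = free_map C F g" "s = free_map C F h"
      "Dom C g = Dom C h" by auto
    then have "\<langle>r, s\<rangle>\<^bsub>K\<^esub> = free_map C F \<langle>g, h\<rangle>\<^bsub>C\<^esub>" by (simp add: free_map_def)
    then show "\<langle>r, s\<rangle>\<^bsub>K\<^esub> \<in> ?S" using gh by auto
  next
    fix A B assume "A \<in> Obj K" "B \<in> Obj K"
    then have "\<pi>\<^sub>1\<^bsub>K\<^esub> A B = free_map C F (\<pi>\<^sub>1\<^bsub>C\<^esub> A B)" "\<pi>\<^sub>1\<^bsub>C\<^esub> A B \<in> Arr C"
      and "\<pi>\<^sub>2\<^bsub>K\<^esub> A B = free_map C F (\<pi>\<^sub>2\<^bsub>C\<^esub> A B)" "\<pi>\<^sub>2\<^bsub>C\<^esub> A B \<in> Arr C"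
      by (simp_all add: free_map_def)
    then show "\<pi>\<^sub>1\<^bsub>K\<^esub> A B \<in> ?S" "\<pi>\<^sub>2\<^bsub>K\<^esub> A B \<in> ?S" by blast+
  next
    fix A assume A: "A \<in> Obj K"
    then show "FObj F A \<in> Obj K" "?\<eta> A \<in> hom K A (FObj F A)" "\<Phi> A \<in> Obj K"
      "?w A \<in> hom K (A \<otimes>\<^bsub>K\<^esub> \<Phi> A) (\<Phi> A)"
      using \<Phi>[of A] by (auto simp: hom_iff coKleisli_Arr bifree_map_def)
  next
    fix k A B assume "k \<in> hom K A B"
    then obtain f where k: "k = (A, f)" "A \<in> Obj C" "f \<in> Arr C" "Dom C f = FObj F A" "Cod C f = B"
      by (cases k) (auto simp: hom_iff coKleisli_Arr)
    show "?lift k \<in> ?S" "?lift k \<in> hom K (FObj F A) B"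
      using k by (auto simp: hom_iff)
    have "free_map C F f \<cdot>\<^bsub>K\<^esub> ?\<eta> A = (A, f)"
      using k by (subst free_map_Comp) (simp_all add: coKleisli_Arr)
    then show "?lift k \<cdot>\<^bsub>K\<^esub> ?\<eta> A = k" by (simp only: k(1) snd_conv)
  next
    fix A X f assume A: "A \<in> Obj K" and X: "X \<in> Obj K" and f: "f \<in> hom K (A \<otimes>\<^bsub>K\<^esub> X) X"
    then have "snd f \<in> hom C (FObj F (A \<otimes>\<^bsub>C\<^esub> X)) X" by (auto simp: hom_iff coKleisli_Arr)
    then obtain u where u: "u \<in> hom C (\<Phi> A) X" "u \<cdot>\<^bsub>C\<^esub> w A = snd f \<cdot>\<^bsub>C\<^esub> FMap F (?T A u)"
      using initial[of A X "snd f"] A X by auto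
    show "\<exists>s\<in>?S. s \<in> hom K (\<Phi> A) X \<and>
      s \<cdot>\<^bsub>K\<^esub> ?w A = f \<cdot>\<^bsub>K\<^esub> \<langle>\<pi>\<^sub>1\<^bsub>K\<^esub> A (\<Phi> A), s \<cdot>\<^bsub>K\<^esub> \<pi>\<^sub>2\<^bsub>K\<^esub> A (\<Phi> A)\<rangle>\<^bsub>K\<^esub>"
    proof (intro bexI conjI)
      show "free_map C F u \<cdot>\<^bsub>K\<^esub> ?w A
          = f \<cdot>\<^bsub>K\<^esub> \<langle>\<pi>\<^sub>1\<^bsub>K\<^esub> A (\<Phi> A), free_map C F u \<cdot>\<^bsub>K\<^esub> \<pi>\<^sub>2\<^bsub>K\<^esub> A (\<Phi> A)\<rangle>\<^bsub>K\<^esub>"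
        using algebra_map_iff[of A f X "w A" "\<Phi> A" u] A f \<Phi>[of A] u
        unfolding bifree_map_def coKleisli_simps(1,6) by blast
    qed (use u in \<open>auto simp: hom_iff\<close>)
  next
    fix A E z assume A: "A \<in> Obj K" and E: "E \<in> Obj K"
      and z: "z \<in> hom K E (FObj F (A \<otimes>\<^bsub>K\<^esub> FObj F E))"
    then obtain x where x: "z = (E, x)" "x \<in> hom C (FObj F E) (FObj F (A \<otimes>\<^bsub>C\<^esub> FObj F E))"
      by (cases z) (auto simp: hom_iff coKleisli_Arr)
    have AE: "A \<in> Obj C" "E \<in> Obj C" "FObj F E \<in> Obj C" using A E by auto
    note w = \<Phi>[OF AE(1)]
    have eq: "?lift (?w A \<cdot>\<^bsub>K\<^esub> \<langle>\<pi>\<^sub>1\<^bsub>K\<^esub> A (FObj F E), ?lift (E, s) \<cdot>\<^bsub>K\<^esub> \<pi>\<^sub>2\<^bsub>K\<^esub> A (FObj F E)\<rangle>\<^bsub>K\<^esub>) \<cdot>\<^bsub>K\<^esub> z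
        = (E, w A \<cdot>\<^bsub>C\<^esub> FMap F (?T A s) \<cdot>\<^bsub>C\<^esub> x)"
      if s: "s \<in> hom C (FObj F E) (\<Phi> A)" for s
    proof -
      have s': "s \<in> Arr C" "Dom C s = FObj F E" "Cod C s = \<Phi> A" using s by (auto simp: hom_iff)
      have p: "?T A s \<in> Arr C" "Dom C (?T A s) = A \<otimes>\<^bsub>C\<^esub> FObj F E" "Cod C (?T A s) = A \<otimes>\<^bsub>C\<^esub> \<Phi> A"
        using s' AE w(1) by (simp_all add: prod_map_Idt)
      have "?w A \<cdot>\<^bsub>K\<^esub> free_map C F (?T A s) = (A \<otimes>\<^bsub>C\<^esub> FObj F E, w A \<cdot>\<^bsub>C\<^esub> FMap F (?T A s))"
        using p w AE by (subst Comp_free_map) (auto simp: bifree_map_def coKleisli_Arr hom_iff)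
      moreover have "free_map C F (w A \<cdot>\<^bsub>C\<^esub> FMap F (?T A s)) \<cdot>\<^bsub>K\<^esub> z
          = (E, (w A \<cdot>\<^bsub>C\<^esub> FMap F (?T A s)) \<cdot>\<^bsub>C\<^esub> x)"
        using p w AE x by (subst free_map_Comp) (auto simp: coKleisli_Arr hom_iff)
      moreover have "(w A \<cdot>\<^bsub>C\<^esub> FMap F (?T A s)) \<cdot>\<^bsub>C\<^esub> x = w A \<cdot>\<^bsub>C\<^esub> FMap F (?T A s) \<cdot>\<^bsub>C\<^esub> x"
        using p w x by (simp add: hom_iff)
      ultimately show ?thesis
        by (simp only: snd_conv free_map_prod_map[OF AE(1) s'(1,2), symmetric])
    qed
    obtain s where s: "s \<in> hom C (FObj F E) (\<Phi> A)" "w A \<cdot>\<^bsub>C\<^esub> FMap F (?T A s) \<cdot>\<^bsub>C\<^esub> x = s"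
      and unique: "\<And>s'. s' \<in> hom C (FObj F E) (\<Phi> A) \<Longrightarrow>
        w A \<cdot>\<^bsub>C\<^esub> FMap F (?T A s') \<cdot>\<^bsub>C\<^esub> x = s' \<Longrightarrow> s' = s"
      using final[OF AE(1,3) x(2)] by blast
    show "\<exists>!y. y \<in> hom K E (\<Phi> A) \<and>
      ?lift (?w A \<cdot>\<^bsub>K\<^esub> \<langle>\<pi>\<^sub>1\<^bsub>K\<^esub> A (FObj F E), ?lift y \<cdot>\<^bsub>K\<^esub> \<pi>\<^sub>2\<^bsub>K\<^esub> A (FObj F E)\<rangle>\<^bsub>K\<^esub>) \<cdot>\<^bsub>K\<^esub> z = y"
    proof (rule ex1I, intro conjI)
      show "(E, s) \<in> hom K E (\<Phi> A)" using s(1) AE by (auto simp: hom_iff coKleisli_Arr)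
      show "?lift (?w A \<cdot>\<^bsub>K\<^esub> \<langle>\<pi>\<^sub>1\<^bsub>K\<^esub> A (FObj F E), ?lift (E, s) \<cdot>\<^bsub>K\<^esub> \<pi>\<^sub>2\<^bsub>K\<^esub> A (FObj F E)\<rangle>\<^bsub>K\<^esub>) \<cdot>\<^bsub>K\<^esub> z
          = (E, s)"
        using eq[OF s(1)] s(2) by (simp only:)
    next
      fix y assume y: "y \<in> hom K E (\<Phi> A) \<and>
        ?lift (?w A \<cdot>\<^bsub>K\<^esub> \<langle>\<pi>\<^sub>1\<^bsub>K\<^esub> A (FObj F E), ?lift y \<cdot>\<^bsub>K\<^esub> \<pi>\<^sub>2\<^bsub>K\<^esub> A (FObj F E)\<rangle>\<^bsub>K\<^esub>) \<cdot>\<^bsub>K\<^esub> z = y"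
      then obtain s' where s': "y = (E, s')" "s' \<in> hom C (FObj F E) (\<Phi> A)"
        by (cases y) (auto simp: hom_iff coKleisli_Arr)
      have "(E, w A \<cdot>\<^bsub>C\<^esub> FMap F (?T A s') \<cdot>\<^bsub>C\<^esub> x) = (E, s')"
        using conjunct2[OF y] unfolding s'(1) eq[OF s'(2)] .
      then show "y = (E, s)" using unique[OF s'(2)] s'(1) by simp
    qed
  qed

  have point: "bifree_point C F \<Phi> w A = point A" for A
    by (simp only: bifree_point_def point_def)
  interpret bifree_fixpoint K zero add D ?S "FObj F" ?\<eta> ?lift \<Phi> ?w "bifree_fixp C F \<Phi> w"
  proof
    fix A X f s
    assume A: "A \<in> Obj K" and X: "X \<in> Obj K" and f: "f \<in> hom K (A \<otimes>\<^bsub>K\<^esub> X) X"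
      and s: "s \<in> ?S" "Dom K s = \<Phi> A" "Cod K s = X"
      and eq: "s \<cdot>\<^bsub>K\<^esub> ?w A = f \<cdot>\<^bsub>K\<^esub> \<langle>\<pi>\<^sub>1\<^bsub>K\<^esub> A (\<Phi> A), s \<cdot>\<^bsub>K\<^esub> \<pi>\<^sub>2\<^bsub>K\<^esub> A (\<Phi> A)\<rangle>\<^bsub>K\<^esub>"
    obtain u where u: "s = free_map C F u" "u \<in> hom C (\<Phi> A) X"
      using s by (auto simp: hom_iff)
    have AC: "A \<in> Obj C" and fC: "f \<in> hom K (A \<otimes>\<^bsub>C\<^esub> X) X" using A f by simp_all
    have fold_iff: "free_map C F u' \<cdot>\<^bsub>K\<^esub> ?w A = f \<cdot>\<^bsub>K\<^esub> free_map C F (?T A u') \<longleftrightarrow>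
        u' \<cdot>\<^bsub>C\<^esub> w A = snd f \<cdot>\<^bsub>C\<^esub> FMap F (?T A u')"
      if u': "u' \<in> hom C (\<Phi> A) X" for u'
      using algebra_map_iff[OF AC fC \<Phi>(2)[OF AC] u'] free_map_prod_map[OF AC, of u' "\<Phi> A"] u'
      by (simp only: bifree_map_def hom_iff)
    have "snd f \<in> hom C (FObj F (A \<otimes>\<^bsub>C\<^esub> X)) X" using f by (auto simp: hom_iff coKleisli_Arr)
    then have "\<exists>!u. u \<in> hom C (\<Phi> A) X \<and> u \<cdot>\<^bsub>C\<^esub> w A = snd f \<cdot>\<^bsub>C\<^esub> FMap F (?T A u)"
      using initial[of A X "snd f"] A X by simp
    moreover have "u \<cdot>\<^bsub>C\<^esub> w A = snd f \<cdot>\<^bsub>C\<^esub> FMap F (?T A u)"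
      using eq unfolding u(1) bifree_map_def algebra_map_iff[OF AC fC \<Phi>(2)[OF AC] u(2)] .
    ultimately have "bifree_fold C F \<Phi> w A X f = u"
      unfolding bifree_fold_def using u(2) fold_iff by (intro the_equality) blast+
    then show "bifree_fixp C F \<Phi> w A X f = s \<cdot>\<^bsub>K\<^esub> point A"
      by (simp only: bifree_fixp_def point u(1))
  qed
  show ?thesis
    using tangent_fixpoint_rule differential_fixpoint_category by blast
qed

end
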